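(* For $p+q\ge4$, there is an isomorphism of graded vector spaces $$H^*_{\mathrm{Lie}}(\mathfrak h_{p,q};\mathbf R)\cong H^*_{\mathrm{Lie}}(\mathfrak{so}(p,q);\mathbf R)\otimes(\mathbf R\oplus\langle v^*\rangle),$$ where $v^*=dx^1\wedge dx^2\wedge\cdots\wedge dx^n$ has degree $n$ and $\mathbf R$ sits in degree $0$.
   Context: Let $p,q$ be nonnegative integers, $n=p+q$. On $\mathbf R^n$ write $\partial_i=\partial/\partial x^i$; $\alpha_{ij}=x_i\partial_j-x_j\partial_i$ ($1\le i<j\le p$ or $p+1\le i<j\le n$), $\beta_{ij}=x_i\partial_j+x_j\partial_i$ ($1\le i\le p<j\le n$). Their span is identified with $\mathfrak{so}(p,q)$; $\mathfrak I_n=\mathrm{span}\{\partial_i\}$; $\mathfrak h_{p,q}$ is the Lie algebra of vector fields with basis $\{\alpha_{ij}\}\cup\{\beta_{ij}\}\cup\{\partial_i\}$. $dx^i$ denotes the linear functional on $\mathfrak h_{p,q}$ dual to $\partial_i$ with respect to this basis (vanishing on all $\alpha_{ij},\beta_{ij}$ and on $\partial_j$, $j\neq i$). $H^*_{\mathrm{Lie}}(\cdot;\mathbf R)$ is Chevalley–Eilenberg cohomology with trivial coefficients. *)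

theory Defs
  imports "HOL-Analysis.Analysis" "HOL-Library.Function_Algebras"
begin

text \<open>A pair (A, b) represents the vector field
  X = sum_i (sum_j A i j * x_j + b i) d/dx^i on R^n (indices 1..n).
  All vector fields in h_{p,q} are of this form.\<close>

type_synonym vf = "(nat \<Rightarrow> nat \<Rightarrow> real) \<times> (nat \<Rightarrow> real)"

definition vf_add :: "vf \<Rightarrow> vf \<Rightarrow> vf" where
  "vf_add X Y = (\<lambda>i j. fst X i j + fst Y i j, \<lambda>i. snd X i + snd Y i)"

definition vf_scale :: "real \<Rightarrow> vf \<Rightarrow> vf" where
  "vf_scale c X = (\<lambda>i j. c * fst X i j, \<lambda>i. c * snd X i)"

definition vf_zero :: vf where
  "vf_zero = (\<lambda>i j. 0, \<lambda>i. 0)"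

text \<open>Lie bracket of vector fields [X,Y]^i = X(Y^i) - Y(X^i), written out for
  affine coefficient fields on R^n.\<close>
definition vf_bracket :: "nat \<Rightarrow> vf \<Rightarrow> vf \<Rightarrow> vf" where
  "vf_bracket n X Y =
     (\<lambda>i j. (\<Sum>k\<in>{1..n}. fst Y i k * fst X k j - fst X i k * fst Y k j),
      \<lambda>i. (\<Sum>k\<in>{1..n}. fst Y i k * snd X k - fst X i k * snd Y k))"

definition xd :: "nat \<Rightarrow> nat \<Rightarrow> vf" where
  "xd i j = (\<lambda>a b. if a = j \<and> b = i then 1 else 0, \<lambda>a. 0)"

definition pd :: "nat \<Rightarrow> vf" where
  "pd i = (\<lambda>a b. 0, \<lambda>a. if a = i then 1 else 0)"

definition alpha :: "nat \<Rightarrow> nat \<Rightarrow> vf" where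
  "alpha i j = vf_add (xd i j) (vf_scale (-1) (xd j i))"

definition beta :: "nat \<Rightarrow> nat \<Rightarrow> vf" where
  "beta i j = vf_add (xd i j) (xd j i)"

definition so_gens :: "nat \<Rightarrow> nat \<Rightarrow> vf set" where
  "so_gens p q =
     {alpha i j | i j. (1 \<le> i \<and> i < j \<and> j \<le> p) \<or> (p + 1 \<le> i \<and> i < j \<and> j \<le> p + q)}
     \<union> {beta i j | i j. 1 \<le> i \<and> i \<le> p \<and> p < j \<and> j \<le> p + q}"

definition transl_gens :: "nat \<Rightarrow> vf set" where
  "transl_gens n = {pd i | i. 1 \<le> i \<and> i \<le> n}"

definition vf_span :: "vf set \<Rightarrow> vf set" where
  "vf_span G = {X. \<exists>c. fst X = (\<lambda>i j. \<Sum>g\<in>G. c g * fst g i j)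
                      \<and> snd X = (\<lambda>i. \<Sum>g\<in>G. c g * snd g i)}"

definition so_alg :: "nat \<Rightarrow> nat \<Rightarrow> vf set" where
  "so_alg p q = vf_span (so_gens p q)"

definition h_alg :: "nat \<Rightarrow> nat \<Rightarrow> vf set" where
  "h_alg p q = vf_span (so_gens p q \<union> transl_gens (p + q))"

text \<open>A k-cochain on a Lie algebra L (subspace of vf with bracket br) is an
  alternating k-linear form on L, represented as a function on sequences
  (nat => vf), depending only on the first k entries which lie in L; it is
  normalized to vanish on sequences outside L^k x {0}^omega.\<close>

definition in_dom :: "vf set \<Rightarrow> nat \<Rightarrow> (nat \<Rightarrow> vf) \<Rightarrow> bool" where
  "in_dom L k vs \<longleftrightarrow> (\<forall>i<k. vs i \<in> L) \<and> (\<forall>i\<ge>k. vs i = vf_zero)"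

definition cochains :: "vf set \<Rightarrow> nat \<Rightarrow> ((nat \<Rightarrow> vf) \<Rightarrow> real) set" where
  "cochains L k = {\<omega>.
     (\<forall>vs. \<not> in_dom L k vs \<longrightarrow> \<omega> vs = 0) \<and>
     (\<forall>vs i u w c. in_dom L k vs \<and> i < k \<and> u \<in> L \<and> w \<in> L \<longrightarrow>
         \<omega> (vs(i := vf_add (vf_scale c u) w)) = c * \<omega> (vs(i := u)) + \<omega> (vs(i := w))) \<and>
     (\<forall>vs i j. in_dom L k vs \<and> i < k \<and> j < k \<and> i \<noteq> j \<and> vs i = vs j \<longrightarrow> \<omega> vs = 0)}"

definition rm :: "nat \<Rightarrow> (nat \<Rightarrow> vf) \<Rightarrow> (nat \<Rightarrow> vf)" where
  "rm i vs = (\<lambda>m. if m < i then vs m else vs (Suc m))"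

definition ce_d :: "(vf \<Rightarrow> vf \<Rightarrow> vf) \<Rightarrow> vf set \<Rightarrow> nat
                     \<Rightarrow> ((nat \<Rightarrow> vf) \<Rightarrow> real) \<Rightarrow> ((nat \<Rightarrow> vf) \<Rightarrow> real)" where
  "ce_d br L k \<omega> = (\<lambda>vs. if in_dom L (Suc k) vs then
      (\<Sum>j\<in>{..k}. \<Sum>i\<in>{..<j}. (-1) ^ (i + j) *
          \<omega> (\<lambda>m. if m = 0 then br (vs i) (vs j) else rm i (rm j vs) (m - 1)))
      else 0)"

definition cocycles :: "(vf \<Rightarrow> vf \<Rightarrow> vf) \<Rightarrow> vf set \<Rightarrow> nat \<Rightarrow> ((nat \<Rightarrow> vf) \<Rightarrow> real) set" where
  "cocycles br L k = {\<omega> \<in> cochains L k. ce_d br L k \<omega> = 0}"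

definition coboundaries :: "(vf \<Rightarrow> vf \<Rightarrow> vf) \<Rightarrow> vf set \<Rightarrow> nat \<Rightarrow> ((nat \<Rightarrow> vf) \<Rightarrow> real) set" where
  "coboundaries br L k = (if k = 0 then {0} else ce_d br L (k - 1) ` cochains L (k - 1))"

abbreviation fdim :: "((nat \<Rightarrow> vf) \<Rightarrow> real) set \<Rightarrow> nat" where
  "fdim \<equiv> Vector_Spaces.vector_space.dim (\<lambda>c f x. c * f x)"

definition lie_betti :: "(vf \<Rightarrow> vf \<Rightarrow> vf) \<Rightarrow> vf set \<Rightarrow> nat \<Rightarrow> nat" where
  "lie_betti br L k = fdim (cocycles br L k) - fdim (coboundaries br L k)"

end

theory Submission
  imports Defs
begin

text \<open>The differential of \<open>h = so \<ltimes> V\<close> preserves the number \<open>b\<close> of arguments from the translation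
  part \<open>V\<close>. The operator \<open>K = \<Sum>\<^sub>i\<^sub>j g\<^sub>j e\<^sup>i \<and> \<iota>(\<partial>\<^sub>j) \<iota>(X\<^sub>i\<^sub>j)\<close>, where \<open>X\<^sub>i\<^sub>j\<close> are the rotations and \<open>g\<close> is the
  signature, contracts with a rotation and lets the dual rotation act on the \<open>V\<close>-arguments only.
  Invariance of the Casimir element gives \<open>d K + K d = b (n - b)\<close>, so only \<open>b = 0\<close> and \<open>b = n\<close>
  contribute to cohomology. These two parts are read off by restriction to \<open>so\<close>, and by
  contraction with \<open>\<partial>\<^sub>1, \<dots>, \<partial>\<^sub>n\<close> followed by restriction; together they form a surjective chain map
  onto the cochains of \<open>so\<close> in degrees \<open>k\<close> and \<open>k - n\<close>, with acyclic kernel. No complete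
  reducibility is needed, and rank-nullity turns this into the Betti number identity.\<close>

subsection \<open>Function spaces and dimensions\<close>

text \<open>The grading by \<open>b\<close> is never split off. All that enters is the counting
  operator \<open>N = number_op\<close> and the polynomial \<open>casimir = n N - N^2\<close>, with
  \<open>n = p + q\<close>, whose eigenvalue \<open>b (n - b)\<close> vanishes only at the two ends.
  The formula for \<open>d K + K d\<close> comes from Cartan calculus: commuting \<open>d\<close>
  past the contraction with a rotation leaves the Lie derivative along that rotation. Its action on
  translation arguments is quadratic once \<open>E i\<close> and \<open>c j\<close> are applied, and
  collapses to \<open>n N - N^2\<close>; its action on rotation arguments cancels against the
  structure equation of \<open>dx^i\<close> and the Lie derivative along the translation. Acyclicity
  of the kernel is then linear algebra: \<open>casimir\<close> is injective there, commutes with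
  \<open>d\<close>, and so is bijective on the finite-dimensional space of closed forms. Betti
  numbers are truncated differences of natural numbers and \<open>dim\<close> of an
  infinite-dimensional space is 0, so finite-dimensionality and the inclusion of coboundaries in
  cocycles have to be carried along.\<close>

instantiation "fun" :: (type, real_vector) real_vector
begin

definition scaleR_fun_def: "c *\<^sub>R f = (\<lambda>x. c *\<^sub>R f x)"

instance
  by standard (simp_all add: fun_eq_iff scaleR_fun_def algebra_simps)

end

lemma scaleR_fun_apply [simp]: "(c *\<^sub>R f) x = c *\<^sub>R f x"
  by (simp add: scaleR_fun_def)

lemma sum_fun_apply: "(\<Sum>i\<in>A. f i) x = (\<Sum>i\<in>A. f i x)"
  by (induction A rule: infinite_finite_induct) simp_all

text \<open>With the pointwise structure made a class instance, the raw dimension in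
  \<open>lie_betti\<close> is the library's \<open>dim\<close>. The same instance turns matrices,
  and hence the product type \<open>vf\<close>, into real vector spaces.\<close>

lemma fdim_eq_dim: "fdim = dim"
  unfolding dim_raw_def scaleR_fun_def by simp

definition fin_dim :: "'a::real_vector set \<Rightarrow> bool" where
  "fin_dim V \<longleftrightarrow> (\<exists>S. finite S \<and> V \<subseteq> span S)"

lemma fin_dim_subset: "fin_dim V \<Longrightarrow> W \<subseteq> V \<Longrightarrow> fin_dim W"
  unfolding fin_dim_def by blast

lemma fin_dim_basis:
  assumes "fin_dim V" "B \<subseteq> V" "independent B"
  shows "finite B"
  using assms independent_span_bound unfolding fin_dim_def by (metis subset_trans)

text \<open>An evaluation that is not identically zero on \<open>W\<close> cuts out a subspace of
  codimension one, at the cost of one more spanning vector; once all evaluations vanish nothing is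
  left.\<close>

lemma fin_dim_of_determining:
  assumes "finite S" "subspace (W :: ('a \<Rightarrow> real) set)"
    and "\<And>f. f \<in> W \<Longrightarrow> (\<And>s. s \<in> S \<Longrightarrow> f s = 0) \<Longrightarrow> f = 0"
  shows "fin_dim W"
  using assms
proof (induction S arbitrary: W rule: finite_induct)
  case empty
  then have "W \<subseteq> {0}" by (auto simp: zero_fun_def)
  then show ?case unfolding fin_dim_def by (intro exI[of _ "{}"]) auto
next
  case (insert s S)
  show ?case
  proof (cases "\<forall>f\<in>W. f s = 0")
    case True
    then show ?thesis using insert by (metis insertE)
  next
    case False
    then obtain f0 where f0: "f0 \<in> W" "f0 s \<noteq> 0" by blast
    let ?W = "{f \<in> W. f s = 0}"
    have "subspace ?W" using insert.prems(1)
      by (auto simp: subspace_def)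
    then have "fin_dim ?W"
      by (rule insert.IH) (use insert.prems(2) in auto)
    then obtain B where B: "finite B" "?W \<subseteq> span B" unfolding fin_dim_def by blast
    have "W \<subseteq> span (insert f0 B)"
    proof
      fix f assume f: "f \<in> W"
      let ?c = "f s / f0 s"
      have "f - ?c *\<^sub>R f0 \<in> ?W"
        using f f0 insert.prems(1) by (simp add: subspace_diff subspace_scale)
      then have "f - ?c *\<^sub>R f0 \<in> span B" using B by blast
      then show "f \<in> span (insert f0 B)" unfolding span_insert by blast
    qed
    then show ?thesis unfolding fin_dim_def using B(1) by blast
  qed
qed

lemma dim_rank_nullity:
  fixes F :: "'a::real_vector \<Rightarrow> 'b::real_vector"
  assumes "linear F" "subspace V" "fin_dim V"
  shows "dim V = dim (F ` V) + dim {v \<in> V. F v = 0}"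
proof -
  let ?N = "{v \<in> V. F v = 0}"
  have sN: "subspace ?N" using assms(1,2)
    by (auto simp: subspace_def linear_0 linear_add linear_cmul)
  obtain B where B: "B \<subseteq> ?N" "independent B" "?N \<subseteq> span B" "card B = dim ?N"
    using basis_exists by blast
  obtain C where C: "B \<subseteq> C" "C \<subseteq> V" "independent C" "V \<subseteq> span C"
    using maximal_independent_subset_extend[of B V] B by blast
  have fC: "finite C" using fin_dim_basis[OF assms(3)] C by blast
  have fB: "finite B" using fC C(1) finite_subset by blast
  have spanB: "span B = ?N" using B(1,3) sN by (simp add: span_minimal subset_antisym)
  have spanC: "span C = V" using C(2,4) assms(2) by (simp add: span_minimal subset_antisym)
  have dimV: "dim V = card C" using C by (metis basis_card_eq_dim)
  have comb: "v \<in> span B" if "v \<in> span (C - B)" "F v = 0" for v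
    using that spanB spanC span_mono[of "C - B" C] by auto
  \<comment> \<open>A kernel vector in the span of \<open>C - B\<close> also lies in the span of
    \<open>B\<close>. Its coordinates with respect to \<open>C\<close> are then supported in two
    disjoint sets, so they all vanish.\<close>
  have zero: "v = 0" if v: "v \<in> span (C - B)" "F v = 0" for v
  proof -
    have "v \<in> span B" using comb v by blast
    then have "representation C v = representation B v" "representation C v = representation (C - B) v"
      using v(1) C(1,3) by (auto intro: real_vector.representation_extend)
    then have "representation C v b = 0" for b
      by (metis Diff_iff real_vector.representation_ne_zero)
    then have "{b. representation C v b \<noteq> 0} = {}" by simp
    then show ?thesis
      using real_vector.sum_nonzero_representation_eq[OF C(3), of v] v(1) spanC
        span_mono[of "C - B" C] by auto
  qed
  have inj: "inj_on F (span (C - B))"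
    using linear_inj_on_iff_eq_0[OF assms(1) subspace_span] zero by blast
  have ind: "independent (F ` (C - B))"
    using linear_independent_injective_image[OF assms(1) _ inj] C(3) independent_mono by blast
  have "F ` V = span (F ` C)" using spanC linear_span_image[OF assms(1)] by metis
  also have "\<dots> = span (F ` (C - B))"
  proof
    have "F ` C \<subseteq> insert 0 (F ` (C - B))" using B(1) by auto
    then show "span (F ` C) \<subseteq> span (F ` (C - B))" by (metis span_insert_0 span_mono)
    show "span (F ` (C - B)) \<subseteq> span (F ` C)" by (intro span_mono) auto
  qed
  finally have "dim (F ` V) = card (F ` (C - B))" using ind by (simp add: dim_eq_card)
  also have "\<dots> = card (C - B)"
    using inj by (intro card_image) (meson inj_on_subset span_superset)
  also have "\<dots> = card C - card B" using fB C(1) by (simp add: card_Diff_subset)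
  finally show ?thesis using dimV B(4) card_mono[OF fC C(1)] by simp
qed

lemma dim_image_inj:
  fixes F :: "'a::real_vector \<Rightarrow> 'b::real_vector"
  assumes "linear F" "subspace V" "\<And>v. v \<in> V \<Longrightarrow> F v = 0 \<Longrightarrow> v = 0"
  shows "dim (F ` V) = dim V"
proof -
  have inj: "inj_on F V"
    using linear_inj_on_iff_eq_0[OF assms(1,2)] assms(3) by blast
  obtain B where B: "B \<subseteq> V" "independent B" "V \<subseteq> span B" "card B = dim V"
    using basis_exists by blast
  have "span B = V" using B assms(2) by (simp add: span_minimal subset_antisym)
  then have "F ` V = span (F ` B)" "independent (F ` B)"
    using linear_span_image[OF assms(1)] linear_independent_injective_image[OF assms(1) B(2)] inj
    by auto
  then have "dim (F ` V) = card (F ` B)" by (simp add: dim_eq_card)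
  then show ?thesis using B inj by (metis card_image inj_on_subset)
qed

text \<open>Injectivity gives the image the full dimension, so a basis of the image, extended inside
  the finite-dimensional \<open>V\<close>, cannot grow.\<close>

lemma surj_of_inj_fin_dim:
  assumes "linear F" "subspace V" "fin_dim V" "F ` V \<subseteq> V" "\<And>v. v \<in> V \<Longrightarrow> F v = 0 \<Longrightarrow> v = 0"
  shows "F ` V = V"
proof -
  have "dim (F ` V) = dim V" using dim_image_inj assms by blast
  obtain B where B: "B \<subseteq> F ` V" "independent B" "F ` V \<subseteq> span B" "card B = dim (F ` V)"
    using basis_exists by blast
  obtain C where C: "B \<subseteq> C" "C \<subseteq> V" "independent C" "V \<subseteq> span C"
    using maximal_independent_subset_extend[of B V] B assms(4) by blast
  have "finite C" using fin_dim_basis[OF assms(3)] C by blast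
  moreover have "card C = dim V" using C by (metis basis_card_eq_dim)
  ultimately have "B = C" using C(1) B(4) \<open>dim (F ` V) = dim V\<close> by (simp add: card_subset_eq)
  then have "V \<subseteq> span (F ` V)" using C(4) B(1) span_mono by blast
  also have "span (F ` V) = F ` V" using linear_span_image[OF assms(1)] assms(2) by (metis span_eq_iff)
  finally show ?thesis using assms(4) by blast
qed

subsection \<open>Alternating forms as functions of lists\<close>

text \<open>A function on lists bundles one form in each degree; this lets contraction, exterior
  multiplication, Lie derivative and differential be defined by recursion on the argument list,
  the recursion equations being the commutation rules with contractions.\<close>

definition ctr :: "'v \<Rightarrow> ('v list \<Rightarrow> real) \<Rightarrow> 'v list \<Rightarrow> real" where
  "ctr x f xs = f (x # xs)"

fun wedge :: "('v \<Rightarrow> real) \<Rightarrow> ('v list \<Rightarrow> real) \<Rightarrow> 'v list \<Rightarrow> real" where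
  "wedge l f [] = 0"
| "wedge l f (x # xs) = l x * f xs - wedge l (ctr x f) xs"

fun lieD :: "('v \<Rightarrow> 'v \<Rightarrow> 'v) \<Rightarrow> 'v \<Rightarrow> ('v list \<Rightarrow> real) \<Rightarrow> 'v list \<Rightarrow> real" where
  "lieD br x f [] = 0"
| "lieD br x f (y # ys) = lieD br x (ctr y f) ys - f (br x y # ys)"

fun ced :: "('v \<Rightarrow> 'v \<Rightarrow> 'v) \<Rightarrow> ('v list \<Rightarrow> real) \<Rightarrow> 'v list \<Rightarrow> real" where
  "ced br f [] = 0"
| "ced br f (x # xs) = lieD br x f xs - ced br (ctr x f) xs"

definition mlin :: "('v::real_vector list \<Rightarrow> real) \<Rightarrow> bool" where
  "mlin f \<longleftrightarrow> (\<forall>ys zs. linear (\<lambda>x. f (ys @ x # zs)))"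

text \<open>Only adjacent repetitions are required to give 0. This shape survives prepending an
  argument and so passes to contractions; arbitrary repetitions are covered by
  \<open>alt_repeated\<close>.\<close>

definition alt :: "('v::real_vector list \<Rightarrow> real) \<Rightarrow> bool" where
  "alt f \<longleftrightarrow> mlin f \<and> (\<forall>ys x zs. f (ys @ x # x # zs) = 0)"

lemma linear_fun_iff: "linear F \<longleftrightarrow> (\<forall>x. linear (\<lambda>f. F f x))" for F :: "'a::real_vector \<Rightarrow> 'b \<Rightarrow> real"
  by (auto simp: linear_iff fun_eq_iff)

lemma linear_ctr: "linear (ctr x)"
  by (rule linearI) (auto simp: ctr_def fun_eq_iff)

lemma linear_wedge: "linear (wedge l)"
proof -
  have "wedge l (f + g) xs = wedge l f xs + wedge l g xs" for f g xs
    by (induction xs arbitrary: f g)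
      (simp_all add: linear_add[OF linear_ctr] algebra_simps)
  moreover have "wedge l (c *\<^sub>R f) xs = c * wedge l f xs" for c f xs
    by (induction xs arbitrary: f)
      (simp_all add: linear_scale[OF linear_ctr] algebra_simps)
  ultimately show ?thesis by (intro linearI) (auto simp: fun_eq_iff)
qed

lemma linear_lieD: "linear (lieD br x)"
proof -
  have "lieD br x (f + g) xs = lieD br x f xs + lieD br x g xs" for f g xs
    by (induction xs arbitrary: f g)
      (simp_all add: linear_add[OF linear_ctr] algebra_simps)
  moreover have "lieD br x (c *\<^sub>R f) xs = c * lieD br x f xs" for c f xs
    by (induction xs arbitrary: f)
      (simp_all add: linear_scale[OF linear_ctr] algebra_simps)
  ultimately show ?thesis by (intro linearI) (auto simp: fun_eq_iff)
qed

lemma linear_ced: "linear (ced br)"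
proof -
  have "ced br (f + g) xs = ced br f xs + ced br g xs" for f g xs
    by (induction xs arbitrary: f g)
      (simp_all add: linear_add[OF linear_ctr] linear_add[OF linear_lieD] algebra_simps)
  moreover have "ced br (c *\<^sub>R f) xs = c * ced br f xs" for c f xs
    by (induction xs arbitrary: f)
      (simp_all add: linear_scale[OF linear_ctr] linear_scale[OF linear_lieD] algebra_simps)
  ultimately show ?thesis by (intro linearI) (auto simp: fun_eq_iff)
qed

lemma wedge_scale_form: "wedge (\<lambda>v. c * l v) f = c *\<^sub>R wedge l f"
proof -
  have "wedge (\<lambda>v. c * l v) f xs = c * wedge l f xs" for xs
    by (induction xs arbitrary: f) (simp_all add: algebra_simps)
  then show ?thesis by (auto simp: fun_eq_iff)
qed

lemmas ctr_simps = linear_add[OF linear_ctr] linear_diff[OF linear_ctr] linear_neg[OF linear_ctr]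
  linear_scale[OF linear_ctr] linear_sum[OF linear_ctr] linear_0[OF linear_ctr]
lemmas wedge_simps = linear_add[OF linear_wedge] linear_diff[OF linear_wedge] linear_neg[OF linear_wedge]
  linear_scale[OF linear_wedge] linear_sum[OF linear_wedge] linear_0[OF linear_wedge]
lemmas lieD_simps = linear_add[OF linear_lieD] linear_diff[OF linear_lieD] linear_neg[OF linear_lieD]
  linear_scale[OF linear_lieD] linear_sum[OF linear_lieD] linear_0[OF linear_lieD]
lemmas ced_simps = linear_add[OF linear_ced] linear_diff[OF linear_ced] linear_neg[OF linear_ced]
  linear_scale[OF linear_ced] linear_sum[OF linear_ced] linear_0[OF linear_ced]

lemma ctr_wedge: "ctr x (wedge l f) = l x *\<^sub>R f - wedge l (ctr x f)"
  by (auto simp: ctr_def fun_eq_iff)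

lemma ctr_lieD: "ctr y (lieD br x f) = lieD br x (ctr y f) - ctr (br x y) f"
  by (auto simp: ctr_def fun_eq_iff)

text \<open>Cartan's formula. It is the recursion of \<open>ced\<close> read as an identity of
  forms, so it holds for every \<open>f\<close>, alternating or not.\<close>

lemma ctr_ced: "ctr x (ced br f) = lieD br x f - ced br (ctr x f)"
  by (auto simp: ctr_def fun_eq_iff)

lemma mlin_ctr: "mlin f \<Longrightarrow> mlin (ctr x f)"
  unfolding mlin_def
proof (intro allI)
  fix ys zs assume "\<forall>ys zs. linear (\<lambda>x. f (ys @ x # zs))"
  then have "linear (\<lambda>y. f ((x # ys) @ y # zs))" by blast
  then show "linear (\<lambda>y. ctr x f (ys @ y # zs))" by (simp add: ctr_def)
qed

lemma alt_ctr: "alt f \<Longrightarrow> alt (ctr x f)"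
  unfolding alt_def
proof (intro conjI allI)
  fix ys y zs assume "mlin f \<and> (\<forall>ys x zs. f (ys @ x # x # zs) = 0)"
  then have "f ((x # ys) @ y # y # zs) = 0" by blast
  then show "ctr x f (ys @ y # y # zs) = 0" by (simp add: ctr_def)
qed (simp add: mlin_ctr)

lemma alt_mlin: "alt f \<Longrightarrow> mlin f"
  by (simp add: alt_def)

lemma linear_ctr_arg: "mlin f \<Longrightarrow> linear (\<lambda>x. ctr x f)"
  unfolding mlin_def by (subst linear_fun_iff, intro allI, drule spec[of _ "[]"]) (simp add: ctr_def)

lemma mlin_arg: "mlin f \<Longrightarrow> linear (\<lambda>x. f (ys @ x # zs))"
  by (simp add: mlin_def)

lemma mlin_add: "mlin f \<Longrightarrow> mlin g \<Longrightarrow> mlin (f + g)"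
  unfolding mlin_def by (simp add: linear_compose_add)

lemma mlin_scale: "mlin f \<Longrightarrow> mlin (c *\<^sub>R f)"
  unfolding mlin_def
  by (auto simp: linear_iff algebra_simps)

lemma subspace_alt: "subspace {f. alt f}"
proof -
  have "mlin 0" by (simp add: mlin_def linear_iff)
  then show ?thesis
    by (auto simp: subspace_def alt_def intro: mlin_add mlin_scale)
qed

lemma mlin_Cons0: "mlin f \<Longrightarrow> f (0 # xs) = 0"
  using linear_0[OF mlin_arg[of f "[]" xs]] by simp

lemma mlinD_add: "mlin f \<Longrightarrow> f ((x + y) # zs) = f (x # zs) + f (y # zs)"
  using linear_add[OF mlin_arg[of f "[]" zs]] by simp

lemma mlinD_scale: "mlin f \<Longrightarrow> f ((c *\<^sub>R x) # zs) = c * f (x # zs)"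
  using linear_scale[OF mlin_arg[of f "[]" zs]] by simp

lemma alt_swap: "alt f \<Longrightarrow> f (ys @ x # y # zs) = - f (ys @ y # x # zs)"
proof -
  assume a: "alt f"
  have add1: "f (ys @ (a + b) # zs') = f (ys @ a # zs') + f (ys @ b # zs')" for a b zs'
    using linear_add[OF mlin_arg[OF alt_mlin[OF a]]] by simp
  have add2: "f (ys @ c # (a + b) # zs) = f (ys @ c # a # zs) + f (ys @ c # b # zs)" for a b c
    using linear_add[OF mlin_arg[OF alt_mlin[OF a], of "ys @ [c]" zs]] by simp
  have "f (ys @ (x + y) # (x + y) # zs) = 0" "f (ys @ x # x # zs) = 0" "f (ys @ y # y # zs) = 0"
    using a by (auto simp: alt_def)
  then show ?thesis by (simp add: add1 add2)
qed

lemma ctr_ctr: "alt f \<Longrightarrow> ctr x (ctr y f) = - ctr y (ctr x f)"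
  using alt_swap[of f "[]" y x] by (auto simp: ctr_def fun_eq_iff)

lemma ctr_ctr_same: "alt f \<Longrightarrow> ctr x (ctr x f) = 0"
  unfolding alt_def ctr_def by (auto simp: fun_eq_iff) (metis append_Nil)

lemma alt_move_front: "alt f \<Longrightarrow> f (ys @ x # zs) = (-1) ^ length ys * f (x # ys @ zs)"
proof (induction ys arbitrary: f)
  case (Cons y ys)
  have "f ((y # ys) @ x # zs) = (-1) ^ length ys * f (y # x # ys @ zs)"
    using Cons.IH[OF alt_ctr[OF Cons.prems, of y]] by (simp add: ctr_def)
  moreover have "f (y # x # ys @ zs) = - f (x # y # ys @ zs)"
    using alt_swap[OF Cons.prems, of "[]" y x "ys @ zs"] by (simp only: append_Nil)
  ultimately show ?case by (simp only: length_Cons append_Cons power_Suc)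
qed simp

lemma alt_repeated: "alt f \<Longrightarrow> \<not> distinct xs \<Longrightarrow> f xs = 0"
proof -
  assume a: "alt f" and "\<not> distinct xs"
  then obtain as y bs cs where xs: "xs = as @ [y] @ bs @ [y] @ cs" using not_distinct_decomp by blast
  have "f (as @ y # y # bs @ cs) = 0" using a by (auto simp: alt_def)
  moreover have "f ((as @ y # bs) @ y # cs) = (-1) ^ length (as @ y # bs) * f (y # (as @ y # bs) @ cs)"
    using alt_move_front[OF a, of "as @ y # bs"] by simp
  moreover have "f (y # as @ y # bs @ cs) = ctr y f (as @ y # bs @ cs)" by (simp add: ctr_def)
  moreover have "ctr y f (as @ y # bs @ cs) = (-1) ^ length as * ctr y f (y # as @ bs @ cs)"
    using alt_move_front[OF alt_ctr[OF a]] by blast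
  moreover have "ctr y f (y # as @ bs @ cs) = 0"
    using ctr_ctr_same[OF a, of y] by (metis ctr_def zero_fun_apply)
  ultimately show ?thesis using xs by simp
qed

lemma mlin_wedge: "linear l \<Longrightarrow> mlin f \<Longrightarrow> mlin (wedge l f)"
proof -
  assume l: "linear l"
  have "linear (\<lambda>x. wedge l f (ys @ x # zs))" if "mlin f" for ys zs
    using that
  proof (induction ys arbitrary: f)
    case Nil
    have "linear (\<lambda>x. wedge l (ctr x f))"
      using linear_compose[OF linear_ctr_arg[OF Nil] linear_wedge] by (simp add: o_def)
    then have "linear (\<lambda>x. wedge l (ctr x f) zs)" by (simp add: linear_fun_iff)
    then show ?case using l by (auto simp: linear_iff algebra_simps)
  next
    case (Cons y ys)
    show ?case
      using Cons.IH[OF mlin_ctr[OF Cons.prems, of y]] mlin_arg[OF Cons.prems, of ys zs]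
      by (auto simp: linear_iff algebra_simps)
  qed
  then show "mlin f \<Longrightarrow> mlin (wedge l f)" by (simp add: mlin_def)
qed

lemma alt_wedge: "linear l \<Longrightarrow> alt f \<Longrightarrow> alt (wedge l f)"
proof -
  assume l: "linear l"
  have "wedge l f (ys @ x # x # zs) = 0" if "alt f" for ys x zs
    using that
  proof (induction ys arbitrary: f)
    case Nil
    have "wedge l f (x # x # zs) = wedge l (ctr x (ctr x f)) zs" by (simp add: ctr_def)
    then show ?case by (simp add: ctr_ctr_same[OF Nil] wedge_simps)
  next
    case (Cons y ys)
    have "f (ys @ x # x # zs) = 0" if "alt f" for f using that by (simp add: alt_def)
    from this[OF Cons.prems] this[OF alt_ctr[OF Cons.prems, of y]] Cons.IH[OF alt_ctr[OF Cons.prems, of y]]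
    show ?case by (simp add: alt_def)
  qed
  then show "alt f \<Longrightarrow> alt (wedge l f)" using l by (simp add: alt_def mlin_wedge)
qed

lemma wedge_wedge: "wedge l (wedge m f) = - wedge m (wedge l f)"
proof -
  have "wedge l (wedge m f) xs = - wedge m (wedge l f) xs" for xs
  proof (induction xs arbitrary: f)
    case (Cons x xs)
    show ?case using Cons[of "ctr x f"] by (simp add: ctr_wedge wedge_simps)
  qed simp
  then show ?thesis by auto
qed

text \<open>\<open>br\<close>, \<open>b1\<close> and \<open>b2\<close> are arbitrary maps, not Lie
  brackets: with its first argument fixed, \<open>lieD\<close> sees only an endomorphism of the
  other one. This lets the bracket with a rotation be treated piece by piece.\<close>

lemma lieD_add_bracket:
  assumes "mlin f" "\<And>y. br x y = b1 x y + b2 x y"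
  shows "lieD br x f = lieD b1 x f + lieD b2 x f"
proof -
  have "lieD br x f xs = lieD b1 x f xs + lieD b2 x f xs" for xs
    using assms(1)
  proof (induction xs arbitrary: f)
    case (Cons y ys)
    then show ?case using Cons.IH[OF mlin_ctr[OF Cons.prems, of y]]
      by (simp add: assms(2) mlinD_add)
  qed simp
  then show ?thesis by auto
qed

text \<open>A derivation is determined by its effect on single arguments, so writing that
  endomorphism as a sum of rank-one maps turns the Lie derivative into wedges after contractions;
  the minus sign comes from passing to the dual.\<close>

lemma lieD_eq_wedge_ctr:
  assumes "alt f" "\<And>y. br x y = (\<Sum>s\<in>S. l s y *\<^sub>R w s)"
  shows "lieD br x f = - (\<Sum>s\<in>S. wedge (l s) (ctr (w s) f))"
proof -
  have "lieD br x f xs = - (\<Sum>s\<in>S. wedge (l s) (ctr (w s) f) xs)" for xs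
    using assms(1)
  proof (induction xs arbitrary: f)
    case (Cons y ys)
    have "f (br x y # ys) = (\<Sum>s\<in>S. l s y * ctr (w s) f ys)"
      unfolding assms(2) using linear_sum[OF linear_ctr_arg[OF alt_mlin[OF Cons.prems]], of "\<lambda>s. l s y *\<^sub>R w s" S]
      by (simp add: fun_eq_iff ctr_def sum_fun_apply mlinD_scale[OF alt_mlin[OF Cons.prems]])
    moreover have "wedge (l s) (ctr y (ctr (w s) f)) = - wedge (l s) (ctr (w s) (ctr y f))" for s
      by (subst ctr_ctr[OF Cons.prems, of y "w s"]) (simp only: wedge_simps)
    ultimately show ?case using Cons.IH[OF alt_ctr[OF Cons.prems, of y]]
      by (simp add: sum_subtractf sum_negf sum.distrib)
  qed simp
  then show ?thesis by (auto simp: sum_fun_apply)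
qed

section \<open>Cartan calculus for a Lie bracket\<close>

locale lie_bracket =
  fixes br :: "'v::real_vector \<Rightarrow> 'v \<Rightarrow> 'v"
  assumes linear_left: "linear (\<lambda>x. br x y)"
    and linear_right: "linear (br x)"
    and self: "br x x = 0"
    and jacobi: "br x (br y z) = br (br x y) z + br y (br x z)"
begin

lemma mlin_lieD: "mlin f \<Longrightarrow> mlin (lieD br x f)"
proof -
  have "linear (\<lambda>y. lieD br x f (ys @ y # zs))" if "mlin f" for ys zs
    using that
  proof (induction ys arbitrary: f)
    case Nil
    have "linear (\<lambda>y. lieD br x (ctr y f))"
      using linear_compose[OF linear_ctr_arg[OF Nil] linear_lieD] by (simp add: o_def)
    then have "linear (\<lambda>y. lieD br x (ctr y f) zs)" by (simp add: linear_fun_iff)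
    moreover have "linear (\<lambda>y. f (br x y # zs))"
      using linear_compose[OF linear_right mlin_arg[OF Nil, of "[]" zs]] by (simp add: o_def)
    ultimately show ?case by (simp add: linear_compose_sub)
  next
    case (Cons y ys)
    show ?case
      using linear_compose_sub[OF Cons.IH[OF mlin_ctr[OF Cons.prems, of y]]
          mlin_arg[OF Cons.prems, of "br x y # ys" zs]] by simp
  qed
  then show "mlin f \<Longrightarrow> mlin (lieD br x f)" by (simp add: mlin_def)
qed

lemma alt_lieD: "alt f \<Longrightarrow> alt (lieD br x f)"
proof -
  have "lieD br x f (ys @ y # y # zs) = 0" if "alt f" for ys y zs
    using that
  proof (induction ys arbitrary: f)
    case Nil
    have "lieD br x f (y # y # zs) = lieD br x (ctr y (ctr y f)) zs - f (y # br x y # zs) - f (br x y # y # zs)"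
      by (simp add: ctr_def)
    then show ?case
      using alt_swap[OF Nil, of "[]" y "br x y" zs] by (simp add: ctr_ctr_same[OF Nil] lieD_simps)
  next
    case (Cons y' ys)
    have "f ((br x y' # ys) @ y # y # zs) = 0" using Cons.prems by (metis alt_def)
    then show ?case using Cons.IH[OF alt_ctr[OF Cons.prems, of y']] by simp
  qed
  then show "alt f \<Longrightarrow> alt (lieD br x f)" by (simp add: alt_def mlin_lieD)
qed

lemma linear_lieD_arg: "mlin f \<Longrightarrow> linear (\<lambda>x. lieD br x f)"
proof -
  have "linear (\<lambda>x. lieD br x f xs)" if "mlin f" for xs
    using that
  proof (induction xs arbitrary: f)
    case (Cons y ys)
    have "linear (\<lambda>x. f (br x y # ys))"
      using linear_compose[OF linear_left[of y] mlin_arg[OF Cons.prems, of "[]" ys]] by (simp add: o_def)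
    then show ?case
      using linear_compose_sub[OF Cons.IH[OF mlin_ctr[OF Cons.prems, of y]]] by simp
  qed (simp add: linear_iff)
  then show "mlin f \<Longrightarrow> linear (\<lambda>x. lieD br x f)" by (subst linear_fun_iff) blast
qed

lemma mlin_ced: "mlin f \<Longrightarrow> mlin (ced br f)"
proof -
  have "linear (\<lambda>y. ced br f (ys @ y # zs))" if "mlin f" for ys zs
    using that
  proof (induction ys arbitrary: f)
    case Nil
    have "linear (\<lambda>y. ced br (ctr y f))"
      using linear_compose[OF linear_ctr_arg[OF Nil] linear_ced] by (simp add: o_def)
    then have "linear (\<lambda>y. lieD br y f - ced br (ctr y f))"
      using linear_lieD_arg[OF Nil] by (rule linear_compose_sub[rotated])
    then show ?case by (subst (asm) linear_fun_iff) simp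
  next
    case (Cons y ys)
    show ?case
      using linear_compose_sub[OF mlin_arg[OF mlin_lieD[OF Cons.prems, of y], of ys zs]
          Cons.IH[OF mlin_ctr[OF Cons.prems, of y]]] by simp
  qed
  then show "mlin f \<Longrightarrow> mlin (ced br f)" by (simp add: mlin_def)
qed

lemma alt_ced: "alt f \<Longrightarrow> alt (ced br f)"
proof -
  have "ced br f (ys @ y # y # zs) = 0" if "alt f" for ys y zs
    using that
  proof (induction ys arbitrary: f)
    case Nil
    then show ?case
      by (simp add: self mlin_Cons0[OF alt_mlin[OF Nil]] ctr_ctr_same[OF Nil] ced_simps)
  next
    case (Cons y' ys)
    have "lieD br y' f (ys @ y # y # zs) = 0" using alt_lieD[OF Cons.prems] by (metis alt_def)
    then show ?case using Cons.IH[OF alt_ctr[OF Cons.prems, of y']] by simp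
  qed
  then show "alt f \<Longrightarrow> alt (ced br f)" by (simp add: alt_def mlin_ced)
qed

lemma lieD_lieD:
  "mlin f \<Longrightarrow> lieD br x (lieD br y f) = lieD br y (lieD br x f) + lieD br (br x y) f"
proof -
  have "lieD br x (lieD br y f) zs = lieD br y (lieD br x f) zs + lieD br (br x y) f zs" if "mlin f" for zs
    using that
  proof (induction zs arbitrary: f)
    case (Cons z zs)
    have "lieD br x (lieD br y (ctr z f)) zs = lieD br y (lieD br x (ctr z f)) zs + lieD br (br x y) (ctr z f) zs"
      by (rule Cons.IH[OF mlin_ctr[OF Cons.prems]])
    then show ?case
      by (simp add: ctr_lieD lieD_simps jacobi[of x y z] mlinD_add[OF Cons.prems])
  qed simp
  then show "mlin f \<Longrightarrow> ?thesis" by (simp add: fun_eq_iff)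
qed

lemma lieD_ced: "mlin f \<Longrightarrow> lieD br x (ced br f) = ced br (lieD br x f)"
proof -
  have "lieD br x (ced br f) zs = ced br (lieD br x f) zs" if "mlin f" for zs
    using that
  proof (induction zs arbitrary: f)
    case (Cons z zs)
    have "lieD br x (ced br (ctr z f)) zs = ced br (lieD br x (ctr z f)) zs"
      by (rule Cons.IH[OF mlin_ctr[OF Cons.prems]])
    then show ?case
      by (simp add: ctr_lieD ctr_ced lieD_simps ced_simps lieD_lieD[OF Cons.prems, of x z])
  qed simp
  then show "mlin f \<Longrightarrow> ?thesis" by (simp add: fun_eq_iff)
qed

text \<open>By Cartan's formula, contracting \<open>ced br (ced br f)\<close> produces the
  commutator of Lie derivative and differential, which is 0 by \<open>lieD_ced\<close>, and the same
  expression for the contracted form.\<close>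

lemma ced_ced: "mlin f \<Longrightarrow> ced br (ced br f) = 0"
proof -
  have "ced br (ced br f) zs = 0" if "mlin f" for zs
    using that
  proof (induction zs arbitrary: f)
    case (Cons z zs)
    then show ?case using Cons.IH[OF mlin_ctr[OF Cons.prems, of z]]
      by (simp add: ctr_ced ced_simps lieD_ced[OF Cons.prems])
  qed simp
  then show "mlin f \<Longrightarrow> ?thesis" by (simp add: fun_eq_iff)
qed

lemma lieD_wedge: "lieD br x (wedge l f) = wedge l (lieD br x f) - wedge (\<lambda>y. l (br x y)) f"
proof -
  have "lieD br x (wedge l f) zs = wedge l (lieD br x f) zs - wedge (\<lambda>y. l (br x y)) f zs" for zs
  proof (induction zs arbitrary: f)
    case (Cons z zs)
    show ?case using Cons.IH[of "ctr z f"]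
      by (simp add: ctr_lieD ctr_wedge lieD_simps wedge_simps)
  qed simp
  then show ?thesis by (simp add: fun_eq_iff)
qed

text \<open>Graded Leibniz rule. The assumption says that the differential of the one-form
  \<open>l\<close>, whose value is \<open>- l (br x y)\<close>, is the sum of the wedge products of
  \<open>m s\<close> with \<open>n s\<close>, in this order.\<close>

lemma ced_wedge:
  assumes "\<And>x y. l (br x y) = (\<Sum>s\<in>S. n s x * m s y - m s x * n s y)"
  shows "ced br (wedge l f) = (\<Sum>s\<in>S. wedge (m s) (wedge (n s) f)) - wedge l (ced br f)"
proof -
  have w: "wedge (\<lambda>y. l (br x y)) f = (\<Sum>s\<in>S. n s x *\<^sub>R wedge (m s) f - m s x *\<^sub>R wedge (n s) f)" for x f
  proof -
    have "wedge (\<lambda>y. \<Sum>s\<in>S. n s x * m s y - m s x * n s y) f zs =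
      (\<Sum>s\<in>S. n s x * wedge (m s) f zs - m s x * wedge (n s) f zs)" for zs
    proof (induction zs arbitrary: f)
      case (Cons z zs)
      show ?case unfolding wedge.simps Cons[of "ctr z f"]
        by (simp add: sum_subtractf sum.distrib sum_distrib_left sum_distrib_right algebra_simps)
    qed simp
    then show ?thesis unfolding assms by (simp add: fun_eq_iff sum_fun_apply)
  qed
  have "ced br (wedge l f) zs = (\<Sum>s\<in>S. wedge (m s) (wedge (n s) f) zs) - wedge l (ced br f) zs" for zs
  proof (induction zs arbitrary: f)
    case (Cons z zs)
    show ?case using Cons.IH[of "ctr z f"]
      by (simp add: ctr_ced ctr_wedge ced_simps wedge_simps lieD_wedge w sum_fun_apply
          sum_subtractf sum.distrib algebra_simps)
  qed simp
  then show ?thesis by (simp add: fun_eq_iff sum_fun_apply)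
qed

end

lemma lieD_map:
  assumes "\<And>x y. br2 (\<theta> x) (\<theta> y) = \<theta> (br1 x y)"
  shows "lieD br2 (\<theta> x) f (map \<theta> ys) = lieD br1 x (\<lambda>zs. f (map \<theta> zs)) ys"
proof (induction ys arbitrary: f)
  case (Cons y ys)
  have "ctr y (\<lambda>zs. f (map \<theta> zs)) = (\<lambda>zs. ctr (\<theta> y) f (map \<theta> zs))" by (auto simp: ctr_def)
  then show ?case using Cons[of "ctr (\<theta> y) f"] by (simp add: assms)
qed simp

text \<open>Pullback along a homomorphism commutes with the differentials. It serves twice with
  \<open>Pso\<close> as the homomorphism: for the inclusion of the rotations into the rigid motions,
  and for the quotient map by the translations.\<close>

lemma ced_map:
  assumes "\<And>x y. br2 (\<theta> x) (\<theta> y) = \<theta> (br1 x y)"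
  shows "ced br2 f (map \<theta> ys) = ced br1 (\<lambda>zs. f (map \<theta> zs)) ys"
proof (induction ys arbitrary: f)
  case (Cons y ys)
  have "ctr y (\<lambda>zs. f (map \<theta> zs)) = (\<lambda>zs. ctr (\<theta> y) f (map \<theta> zs))" by (auto simp: ctr_def)
  then show ?case using Cons[of "ctr (\<theta> y) f"]
    by (simp add: lieD_map[of br2 \<theta> br1, OF assms])
qed simp

definition del :: "nat \<Rightarrow> 'a list \<Rightarrow> 'a list" where
  "del i xs = take i xs @ drop (Suc i) xs"

lemma del_0 [simp]: "del 0 (x # xs) = xs"
  by (simp add: del_def)

lemma del_Suc [simp]: "del (Suc i) (x # xs) = x # del i xs"
  by (simp add: del_def)

lemma lieD_eq_sum:
  assumes "alt f"
  shows "lieD br x f ys = - (\<Sum>j<length ys. (-1) ^ j * f (br x (ys ! j) # del j ys))"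
  using assms
proof (induction ys arbitrary: f)
  case (Cons y ys)
  have "ctr y f (v # zs) = - f (v # y # zs)" for v zs
    using alt_swap[OF Cons.prems, of "[]" y v zs] by (simp add: ctr_def)
  then show ?case using Cons.IH[OF alt_ctr[OF Cons.prems, of y]]
    by (simp add: sum.lessThan_Suc_shift sum_negf del: sum.lessThan_Suc)
qed simp

text \<open>The recursion leaves every later bracket behind the first argument \<open>x\<close>.
  Alternation moves it to the front, and the resulting sign cancels the minus in \<open>ced\<close>;
  this fits the sum because shifting both \<open>i\<close> and \<open>j\<close> by one keeps
  \<open>(-1) ^ (i + j)\<close>.\<close>

lemma ced_eq_sum:
  assumes "alt f"
  shows "ced br f xs = (\<Sum>j<length xs. \<Sum>i<j. (-1) ^ (i + j) * f (br (xs ! i) (xs ! j) # del i (del j xs)))"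
  using assms
proof (induction xs arbitrary: f)
  case (Cons x xs)
  have "ctr x f (v # zs) = - f (v # x # zs)" for v zs
    using alt_swap[OF Cons.prems, of "[]" x v zs] by (simp add: ctr_def)
  then show ?case using Cons.IH[OF alt_ctr[OF Cons.prems, of x]] lieD_eq_sum[OF Cons.prems, of br x xs]
    by (simp add: sum.lessThan_Suc_shift sum_negf sum.distrib sum_subtractf del: sum.lessThan_Suc)
qed simp

subsection \<open>The Lie algebras of rotations and of rigid motions\<close>

definition mm :: "nat \<Rightarrow> (nat \<Rightarrow> nat \<Rightarrow> real) \<Rightarrow> (nat \<Rightarrow> nat \<Rightarrow> real) \<Rightarrow> nat \<Rightarrow> nat \<Rightarrow> real" where
  "mm n A B i j = (\<Sum>k\<in>{1..n}. A i k * B k j)"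

definition mv :: "nat \<Rightarrow> (nat \<Rightarrow> nat \<Rightarrow> real) \<Rightarrow> (nat \<Rightarrow> real) \<Rightarrow> nat \<Rightarrow> real" where
  "mv n A b i = (\<Sum>k\<in>{1..n}. A i k * b k)"

text \<open>For affine fields with matrix parts \<open>A\<close> and \<open>B\<close> the bracket is
  the opposite of the matrix commutator.\<close>

lemma vf_bracket_eq:
  "vf_bracket n X Y = (mm n (fst Y) (fst X) - mm n (fst X) (fst Y), mv n (fst Y) (snd X) - mv n (fst X) (snd Y))"
  by (auto simp: vf_bracket_def mm_def mv_def fun_eq_iff sum_subtractf)

lemma mm_assoc: "mm n (mm n A B) C = mm n A (mm n B C)"
proof -
  have "(\<Sum>k\<in>S. (\<Sum>l\<in>S. A i l * B l k) * C k j) = (\<Sum>l\<in>S. A i l * (\<Sum>k\<in>S. B l k * C k j))" for i j S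
    unfolding sum_distrib_left sum_distrib_right by (subst sum.swap) (simp add: mult.assoc)
  then show ?thesis by (simp add: mm_def fun_eq_iff)
qed

lemma mv_mm: "mv n (mm n A B) b = mv n A (mv n B b)"
proof -
  have "(\<Sum>k\<in>S. (\<Sum>l\<in>S. A i l * B l k) * b k) = (\<Sum>l\<in>S. A i l * (\<Sum>k\<in>S. B l k * b k))" for i S
    unfolding sum_distrib_left sum_distrib_right by (subst sum.swap) (simp add: mult.assoc)
  then show ?thesis by (simp add: mv_def mm_def fun_eq_iff)
qed

lemma mm_linear:
  "mm n (A + B) C = mm n A C + mm n B C" "mm n C (A + B) = mm n C A + mm n C B"
  "mm n (A - B) C = mm n A C - mm n B C" "mm n C (A - B) = mm n C A - mm n C B"
  "mm n (c *\<^sub>R A) C = c *\<^sub>R mm n A C" "mm n C (c *\<^sub>R A) = c *\<^sub>R mm n C A"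
  by (auto simp: mm_def fun_eq_iff algebra_simps sum.distrib sum_subtractf sum_distrib_left)

lemma mv_linear:
  "mv n (A + B) b = mv n A b + mv n B b" "mv n C (a + b) = mv n C a + mv n C b"
  "mv n (A - B) b = mv n A b - mv n B b" "mv n C (a - b) = mv n C a - mv n C b"
  "mv n (c *\<^sub>R A) b = c *\<^sub>R mv n A b" "mv n C (c *\<^sub>R a) = c *\<^sub>R mv n C a"
  by (auto simp: mv_def fun_eq_iff algebra_simps sum.distrib sum_subtractf sum_distrib_left)

lemma lie_bracket_vf_bracket: "lie_bracket (vf_bracket n)"
proof (rule lie_bracket.intro)
  show "linear (\<lambda>X. vf_bracket n X Y)" for Y
    by (rule linearI) (simp_all add: vf_bracket_eq mm_linear mv_linear algebra_simps)
  show "linear (vf_bracket n X)" for X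
    by (rule linearI) (simp_all add: vf_bracket_eq mm_linear mv_linear algebra_simps)
  show "vf_bracket n X X = 0" for X
    by (simp add: vf_bracket_eq zero_prod_def)
  show "vf_bracket n X (vf_bracket n Y Z) =
      vf_bracket n (vf_bracket n X Y) Z + vf_bracket n Y (vf_bracket n X Z)" for X Y Z
    by (simp add: vf_bracket_eq mm_linear mv_linear mm_assoc mv_mm)
qed

text \<open>If \<open>P\<close> fixes the brackets of vectors in its range, precomposing with
  \<open>P\<close> gives a Lie bracket on the whole type. Subalgebras can thus be handled without
  carrier sets.\<close>

lemma (in lie_bracket) lie_bracket_proj:
  assumes "linear P" "\<And>x y. P (br (P x) (P y)) = br (P x) (P y)"
  shows "lie_bracket (\<lambda>x y. br (P x) (P y))"
proof (rule lie_bracket.intro)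
  show "linear (\<lambda>x. br (P x) (P y))" for y
    using linear_compose[OF assms(1) linear_left] by (simp add: o_def)
  show "linear (\<lambda>y. br (P x) (P y))" for x
    using linear_compose[OF assms(1) linear_right] by (simp add: o_def)
  show "br (P x) (P x) = 0" for x by (rule self)
  show "br (P x) (P (br (P y) (P z))) = br (P (br (P x) (P y))) (P z) + br (P y) (P (br (P x) (P z)))" for x y z
    unfolding assms(2) by (rule jacobi)
qed

text \<open>Positivity of \<open>p + q\<close> keeps the two surviving parts, with no translation
  and with all of them, apart.\<close>

locale pseudo_euclidean =
  fixes p q :: nat
  assumes pos: "p + q \<ge> 1"
begin

abbreviation I :: "nat set" where "I \<equiv> {1..p + q}"

definition sg :: "nat \<Rightarrow> real" where
  "sg i = (if i \<le> p then 1 else - 1)"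

text \<open>The rotations are the matrices with \<open>A = - g A^t g\<close>, where \<open>g\<close>
  is the diagonal matrix of the \<open>sg i\<close>. This is the projection of \<open>A\<close> to
  \<open>(A - g A^t g) / 2\<close>, cut off to the indices in \<open>I\<close> and with the
  translation part dropped.\<close>

definition Pso :: "vf \<Rightarrow> vf" where
  "Pso v = (\<lambda>i j. if i \<in> I \<and> j \<in> I then (fst v i j - sg i * sg j * fst v j i) / 2 else 0, 0)"

definition Ph :: "vf \<Rightarrow> vf" where
  "Ph v = (fst (Pso v), \<lambda>i. if i \<in> I then snd v i else 0)"

text \<open>For distinct indices in \<open>I\<close> this is, up to sign, one of the given
  generators, uniformly inside a block and across the two blocks. It is taken for all ordered pairs,
  so that sums run over \<open>I \<times> I\<close> without an ordering; the double count reappears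
  as the factor 1/2 in \<open>Ph_decomp\<close>.\<close>

definition so_basis :: "nat \<Rightarrow> nat \<Rightarrow> vf" where
  "so_basis i j = (\<lambda>a b. (if a = i \<and> b = j then sg j else 0) - (if a = j \<and> b = i then sg i else 0), 0)"

definition trl :: "nat \<Rightarrow> vf \<Rightarrow> real" where
  "trl i v = snd v i"

definition rot :: "nat \<Rightarrow> nat \<Rightarrow> vf \<Rightarrow> real" where
  "rot i j v = fst (Pso v) i j"

definition brs :: "vf \<Rightarrow> vf \<Rightarrow> vf" where
  "brs x y = vf_bracket (p + q) (Pso x) (Pso y)"

definition brh :: "vf \<Rightarrow> vf \<Rightarrow> vf" where
  "brh x y = vf_bracket (p + q) (Ph x) (Ph y)"

lemma sg_sq [simp]: "sg i * sg i = 1"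
  by (simp add: sg_def)

lemma sg_sq_left [simp]: "sg i * (sg i * x) = x"
  by (simp add: sg_def)

lemma linear_Pso: "linear Pso"
  by (rule linearI) (auto simp: Pso_def fun_eq_iff field_simps)

lemma linear_Ph: "linear Ph"
  by (rule linearI) (auto simp: Ph_def fun_eq_iff linear_add[OF linear_Pso] linear_scale[OF linear_Pso])

lemma linear_trl: "linear (trl i)"
  by (rule linearI) (auto simp: trl_def)

lemma linear_rot: "linear (rot i j)"
  by (rule linearI) (auto simp: rot_def linear_add[OF linear_Pso] linear_scale[OF linear_Pso])

lemma snd_Pso [simp]: "snd (Pso v) = 0"
  by (simp add: Pso_def)

lemma rot_outside: "i \<notin> I \<or> j \<notin> I \<Longrightarrow> rot i j v = 0"
  unfolding rot_def Pso_def by auto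

lemma rot_skew: "rot i j v = - sg i * sg j * rot j i v"
  by (auto simp: rot_def Pso_def field_simps)

lemma rot_skew': "sg j * rot i j v = - (sg i * rot j i v)"
  by (subst rot_skew) simp

lemma rot_skew'': "sg i * rot i j v = - (sg j * rot j i v)"
  by (subst rot_skew) simp

lemma rot_diag [simp]: "rot i i v = 0"
  using rot_skew[of i i v] by simp

lemma fst_Ph: "fst (Ph v) = fst (Pso v)"
  by (simp add: Ph_def)

lemma Pso_fix_iff:
  "Pso v = v \<longleftrightarrow> (\<forall>i j. i \<notin> I \<or> j \<notin> I \<longrightarrow> fst v i j = 0) \<and> (\<forall>i j. fst v i j = - sg i * sg j * fst v j i) \<and> snd v = 0"
  (is "_ \<longleftrightarrow> ?R")
proof
  assume e: "Pso v = v"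
  show ?R
    using rot_outside[of _ _ v] rot_skew[of _ _ v] snd_Pso[of v] unfolding rot_def e by blast
next
  assume R: ?R
  have s: "sg i * sg j * fst v j i = - fst v i j" for i j
    using R[THEN conjunct2, THEN conjunct1, rule_format, of i j] by simp
  have "fst (Pso v) i j = fst v i j" for i j
    using R[THEN conjunct1, rule_format, of i j] s[of i j] by (simp add: Pso_def)
  then show "Pso v = v"
    using R[THEN conjunct2, THEN conjunct2] by (intro prod_eqI ext) simp_all
qed

lemma Pso_Pso [simp]: "Pso (Pso v) = Pso v"
  unfolding Pso_fix_iff
  using rot_outside[of _ _ v] rot_skew[of _ _ v] snd_Pso[of v] unfolding rot_def by blast

lemma Pso_cong:
  assumes "fst v = fst w"
  shows "Pso v = Pso w"
  unfolding Pso_def assms ..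

lemma Pso_Ph [simp]: "Pso (Ph v) = Pso v"
  by (metis Pso_cong Pso_Pso fst_Ph)

lemma Ph_Pso [simp]: "Ph (Pso v) = Pso v"
  unfolding Ph_def by (intro prod_eqI) (auto simp: fun_eq_iff)

lemma Ph_Ph [simp]: "Ph (Ph v) = Ph v"
  unfolding Ph_def Pso_Ph[unfolded Ph_def] by auto

lemma trl_Ph: "i \<in> I \<Longrightarrow> trl i (Ph v) = trl i v"
  by (simp add: trl_def Ph_def)

lemma trl_Pso [simp]: "trl i (Pso v) = 0"
  by (simp add: trl_def)

text \<open>Skewness applied to all four matrix entries of a summand exchanges its two products; the
  signs attached to the summation index \<open>k\<close> occur twice and cancel.\<close>

lemma brs_Pso: "Pso (vf_bracket (p + q) (Pso x) (Pso y)) = vf_bracket (p + q) (Pso x) (Pso y)"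
proof -
  let ?A = "\<lambda>i j. rot i j x" and ?B = "\<lambda>i j. rot i j y"
  have f: "fst (vf_bracket (p + q) (Pso x) (Pso y)) i j = (\<Sum>k\<in>I. ?B i k * ?A k j - ?A i k * ?B k j)" for i j
    by (simp add: vf_bracket_def rot_def)
  have "(\<Sum>k\<in>I. ?B i k * ?A k j - ?A i k * ?B k j) = - sg i * sg j * (\<Sum>k\<in>I. ?B j k * ?A k i - ?A j k * ?B k i)" for i j
    unfolding sum_distrib_left
  proof (rule sum.cong[OF refl])
    fix k
    show "?B i k * ?A k j - ?A i k * ?B k j = - sg i * sg j * (?B j k * ?A k i - ?A j k * ?B k i)"
      unfolding rot_skew[of i k x] rot_skew[of k j x] rot_skew[of i k y] rot_skew[of k j y]
      by (simp add: algebra_simps)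
  qed
  moreover have "snd (vf_bracket (p + q) (Pso x) (Pso y)) = 0"
    by (simp add: vf_bracket_def fun_eq_iff)
  moreover have "(\<Sum>k\<in>I. ?B i k * ?A k j - ?A i k * ?B k j) = 0" if "i \<notin> I \<or> j \<notin> I" for i j
    using that by (intro sum.neutral) (metis rot_outside diff_self mult_zero_left mult_zero_right)
  ultimately show ?thesis unfolding Pso_fix_iff f by blast
qed

lemma Ph_fix_iff: "Ph v = v \<longleftrightarrow> fst (Pso v) = fst v \<and> (\<forall>i. i \<notin> I \<longrightarrow> snd v i = 0)"
  unfolding Ph_def by (cases v) (auto simp: fun_eq_iff)

lemma fst_bracket_Ph: "fst (vf_bracket (p + q) (Ph x) (Ph y)) = fst (vf_bracket (p + q) (Pso x) (Pso y))"
  by (simp add: vf_bracket_def fst_Ph)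

lemma Pso_bracket_Ph: "Pso (vf_bracket (p + q) (Ph x) (Ph y)) = vf_bracket (p + q) (Pso x) (Pso y)"
  using Pso_cong[OF fst_bracket_Ph] brs_Pso by metis

lemma brh_Ph: "Ph (vf_bracket (p + q) (Ph x) (Ph y)) = vf_bracket (p + q) (Ph x) (Ph y)"
  unfolding Ph_fix_iff Pso_bracket_Ph fst_bracket_Ph
  using rot_outside by (auto simp: vf_bracket_def fst_Ph rot_def[symmetric])

sublocale brs: lie_bracket brs
  unfolding brs_def
  by (rule lie_bracket.lie_bracket_proj[where P = Pso and br = "vf_bracket (p + q)",
        OF lie_bracket_vf_bracket linear_Pso brs_Pso])

sublocale brh: lie_bracket brh
  unfolding brh_def
  by (rule lie_bracket.lie_bracket_proj[where P = Ph and br = "vf_bracket (p + q)",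
        OF lie_bracket_vf_bracket linear_Ph brh_Ph])

lemma brh_pd:
  assumes "j \<in> I"
  shows "brh (pd j) v = (\<Sum>m\<in>I. rot m j v *\<^sub>R pd m)"
proof (rule prod_eqI)
  have p: "Pso (pd j) = 0" by (rule prod_eqI) (auto simp: Pso_def pd_def fun_eq_iff)
  have "fst (\<Sum>m\<in>I. rot m j v *\<^sub>R pd m) = 0"
    by (simp add: fst_sum pd_def zero_fun_def[symmetric])
  then show "fst (brh (pd j) v) = fst (\<Sum>m\<in>I. rot m j v *\<^sub>R pd m)"
    by (simp add: brh_def vf_bracket_eq fst_Ph p mm_def fun_eq_iff)
  have s: "snd (Ph (pd j)) = (\<lambda>i. if i = j then 1 else 0)"
    using assms by (auto simp: Ph_def pd_def)
  have "snd (brh (pd j) v) i = rot i j v" for i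
    using assms by (simp add: brh_def vf_bracket_def fst_Ph p s if_distrib[of "\<lambda>x. _ * x"] flip: rot_def cong: if_cong)
  moreover have "snd (\<Sum>m\<in>I. rot m j v *\<^sub>R pd m) i = rot i j v" for i
    using rot_outside[of i j v]
    by (auto simp: snd_sum sum_fun_apply pd_def if_distrib[of "\<lambda>x. _ * x"] cong: if_cong)
  ultimately show "snd (brh (pd j) v) = snd (\<Sum>m\<in>I. rot m j v *\<^sub>R pd m)" by auto
qed

lemma fst_so_basis: "fst (so_basis i j) a b = (if a = i \<and> b = j then sg j else 0) - (if a = j \<and> b = i then sg i else 0)"
  by (simp add: so_basis_def)

lemma snd_so_basis [simp]: "snd (so_basis i j) = 0"
  by (simp add: so_basis_def)

lemma so_basis_outside:
  assumes "i \<in> I" "j \<in> I" "a \<notin> I \<or> b \<notin> I"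
  shows "fst (so_basis i j) a b = 0"
proof -
  have "\<not> (a = i \<and> b = j)" "\<not> (a = j \<and> b = i)" using assms by blast+
  then show ?thesis unfolding fst_so_basis by (simp only: if_False diff_self)
qed

lemma Pso_so_basis:
  assumes "i \<in> I" "j \<in> I"
  shows "Pso (so_basis i j) = so_basis i j"
  unfolding Pso_fix_iff
proof (intro conjI allI impI)
  fix a b
  show "fst (so_basis i j) a b = 0" if "a \<notin> I \<or> b \<notin> I"
    using so_basis_outside assms that by blast
  show "fst (so_basis i j) a b = - sg a * sg b * fst (so_basis i j) b a"
    unfolding fst_so_basis by (cases "a = i"; cases "b = j"; cases "a = j"; cases "b = i") simp_all
qed simp

text \<open>The bracket with a rotation in the form needed for \<open>lieD_eq_wedge_ctr\<close>: the
  first two terms are its action on translations, the two sums its adjoint action on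
  rotations.\<close>

lemma brh_so_basis:
  assumes "i \<in> I" "j \<in> I"
  shows "brh (so_basis i j) v =
    (sg i * trl i v) *\<^sub>R pd j + (- sg j * trl j v) *\<^sub>R pd i
    + ((\<Sum>k\<in>I. rot k i v *\<^sub>R so_basis k j) + (\<Sum>k\<in>I. rot k j v *\<^sub>R so_basis i k))"
    (is "_ = ?R")
proof (rule prod_eqI)
  have P: "Ph (so_basis i j) = so_basis i j"
    using Pso_so_basis[OF assms] by (metis Ph_Pso)
  have "fst (brh (so_basis i j) v) a b = fst ?R a b" for a b
  proof -
    have "fst (brh (so_basis i j) v) a b =
      (if b = j then sg j * rot a i v else 0) - (if b = i then sg i * rot a j v else 0)
      - (if a = i then sg j * rot j b v else 0) + (if a = j then sg i * rot i b v else 0)"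
      using assms
      by (simp add: brh_def vf_bracket_def P fst_Ph fst_so_basis rot_def[symmetric] sum_subtractf
          right_diff_distrib left_diff_distrib if_distrib[of "\<lambda>x. _ * x"] if_distrib[of "\<lambda>x. x * _"] if_if_eq_conj[symmetric]
          mult.commute cong: if_cong)
    moreover have "fst ?R a b =
      (if b = j then sg j * rot a i v else 0) - (if a = j then sg b * rot b i v else 0)
       + (if a = i then sg b * rot b j v else 0) - (if b = i then sg i * rot a j v else 0)"
      using rot_outside[of a] rot_outside[of b] assms
      by (auto simp: pd_def fst_sum sum_fun_apply fst_so_basis sum_subtractf
          right_diff_distrib if_distrib[of "\<lambda>x. _ * x"] if_if_eq_conj[symmetric]
          mult.commute cong: if_cong)
    \<comment> \<open>The bracket yields rows of the matrix of \<open>v\<close> where the right side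
      has columns; skewness exchanges them.\<close>
    moreover have "(if a = j then sg b * rot b i v else 0) = - (if a = j then sg i * rot i b v else 0)"
      "(if a = i then sg b * rot b j v else 0) = - (if a = i then sg j * rot j b v else 0)"
      using rot_skew''[of b i v] rot_skew''[of b j v] by auto
    ultimately show ?thesis by linarith
  qed
  then show "fst (brh (so_basis i j) v) = fst ?R" by (intro ext)
  have "snd (brh (so_basis i j) v) a = snd ?R a" for a
  proof -
    have "snd (brh (so_basis i j) v) a =
      (if a = j then sg i * trl i v else 0) - (if a = i then sg j * trl j v else 0)"
      using assms
      by (simp add: brh_def vf_bracket_def P fst_so_basis Ph_def trl_def Pso_so_basis[OF assms]
          left_diff_distrib sum_subtractf sum_negf if_distrib[of "\<lambda>x. x * _"] if_if_eq_conj[symmetric] cong: if_cong)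
    then show ?thesis by (auto simp: pd_def snd_sum sum_fun_apply)
  qed
  then show "snd (brh (so_basis i j) v) = snd ?R" by (intro ext)
qed

text \<open>The structure equation behind the differential of \<open>dx^i\<close>, arranged as the
  assumption of \<open>ced_wedge\<close>.\<close>

lemma trl_brh:
  "trl i (brh x y) = (\<Sum>j\<in>I. trl j x * rot i j y - rot i j x * trl j y)"
proof -
  have "trl i (brh x y) = (\<Sum>k\<in>I. rot i k y * snd (Ph x) k - rot i k x * snd (Ph y) k)"
    unfolding trl_def brh_def vf_bracket_def rot_def fst_Ph by (simp only: snd_conv)
  also have "\<dots> = (\<Sum>k\<in>I. trl k x * rot i k y - rot i k x * trl k y)"
  proof (rule sum.cong[OF refl])
    fix k assume "k \<in> I"
    then have "snd (Ph x) k = trl k x" "snd (Ph y) k = trl k y" by (simp_all add: Ph_def trl_def)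
    then show "rot i k y * snd (Ph x) k - rot i k x * snd (Ph y) k = trl k x * rot i k y - rot i k x * trl k y"
      by simp
  qed
  finally show ?thesis .
qed

lemma Ph_decomp:
  "Ph v = (\<Sum>i\<in>I. \<Sum>j\<in>I. (rot i j v * sg j / 2) *\<^sub>R so_basis i j) + (\<Sum>i\<in>I. trl i v *\<^sub>R pd i)"
proof (rule prod_eqI)
  have "(\<Sum>i\<in>I. \<Sum>j\<in>I. (rot i j v * sg j / 2) * fst (so_basis i j) a b) = rot a b v" for a b
  proof -
    have "(\<Sum>i\<in>I. \<Sum>j\<in>I. (rot i j v * sg j / 2) * fst (so_basis i j) a b) =
      rot a b v / 2 - rot b a v * sg a * sg b / 2"
    proof (cases "a \<in> I \<and> b \<in> I")
      case True
      have "(\<Sum>j\<in>S. if c then f j else 0) = (if c then sum f S else 0)" for c S and f :: "nat \<Rightarrow> real"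
        by simp
      with True show ?thesis
        by (simp add: fst_so_basis sum_subtractf right_diff_distrib
            if_distrib[of "\<lambda>x. _ * x"] if_if_eq_conj[symmetric] cong: if_cong)
    next
      case False
      have "(\<Sum>i\<in>I. \<Sum>j\<in>I. (rot i j v * sg j / 2) * fst (so_basis i j) a b) = 0"
        by (intro sum.neutral ballI) (use so_basis_outside False in \<open>metis mult_zero_right\<close>)
      moreover have "rot a b v = 0" "rot b a v = 0" using rot_outside False by blast+
      ultimately show ?thesis by simp
    qed
    then show ?thesis using rot_skew[of a b v] by (simp add: algebra_simps)
  qed
  then show "fst (Ph v) = fst ((\<Sum>i\<in>I. \<Sum>j\<in>I. (rot i j v * sg j / 2) *\<^sub>R so_basis i j) + (\<Sum>i\<in>I. trl i v *\<^sub>R pd i))"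
    by (simp add: fun_eq_iff fst_sum sum_fun_apply fst_Ph rot_def[symmetric] pd_def)
  show "snd (Ph v) = snd ((\<Sum>i\<in>I. \<Sum>j\<in>I. (rot i j v * sg j / 2) *\<^sub>R so_basis i j) + (\<Sum>i\<in>I. trl i v *\<^sub>R pd i))"
    by (auto simp: fun_eq_iff snd_sum sum_fun_apply Ph_def trl_def pd_def if_distrib[of "\<lambda>x. _ * x"] cong: if_cong)
qed

section \<open>The counting operator and the homotopy operator\<close>

abbreviation E :: "nat \<Rightarrow> (vf list \<Rightarrow> real) \<Rightarrow> vf list \<Rightarrow> real" where "E i \<equiv> wedge (trl i)"
abbreviation R :: "nat \<Rightarrow> nat \<Rightarrow> (vf list \<Rightarrow> real) \<Rightarrow> vf list \<Rightarrow> real" where "R i j \<equiv> wedge (rot i j)"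
abbreviation c :: "nat \<Rightarrow> (vf list \<Rightarrow> real) \<Rightarrow> vf list \<Rightarrow> real" where "c i \<equiv> ctr (pd i)"
abbreviation s :: "nat \<Rightarrow> nat \<Rightarrow> (vf list \<Rightarrow> real) \<Rightarrow> vf list \<Rightarrow> real" where "s i j \<equiv> ctr (so_basis i j)"
abbreviation d :: "(vf list \<Rightarrow> real) \<Rightarrow> vf list \<Rightarrow> real" where "d \<equiv> ced brh"

definition number_op :: "(vf list \<Rightarrow> real) \<Rightarrow> vf list \<Rightarrow> real" where
  "number_op f = (\<Sum>i\<in>I. E i (c i f))"

definition homotopy :: "(vf list \<Rightarrow> real) \<Rightarrow> vf list \<Rightarrow> real" where
  "homotopy f = (\<Sum>i\<in>I. \<Sum>j\<in>I. sg j *\<^sub>R E i (c j (s i j f)))"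

lemma trl_pd: "trl i (pd j) = (if i = j then 1 else 0)"
  by (simp add: trl_def pd_def)

lemma Pso_pd [simp]: "Pso (pd j) = 0"
  by (rule prod_eqI) (auto simp: Pso_def pd_def fun_eq_iff)

lemma rot_pd [simp]: "rot i j (pd k) = 0"
  by (simp add: rot_def)

lemma c_R: "c k (R i j f) = - R i j (c k f)"
  by (simp add: ctr_wedge)

lemma c_E: "c k (E i f) = (if i = k then f else 0) - E i (c k f)"
  by (simp add: ctr_wedge trl_pd)

lemma lieD_pd:
  assumes "alt f" "j \<in> I"
  shows "lieD brh (pd j) f = - (\<Sum>m\<in>I. R m j (c m f))"
  using lieD_eq_wedge_ctr[OF assms(1), of brh "pd j" "\<lambda>m. rot m j" pd I] brh_pd[OF assms(2)] by blast

lemma lieD_so_basis: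
  assumes "alt f" "i \<in> I" "j \<in> I"
  shows "lieD brh (so_basis i j) f =
    sg j *\<^sub>R E j (c i f) - sg i *\<^sub>R E i (c j f) - ((\<Sum>k\<in>I. R k i (s k j f)) + (\<Sum>k\<in>I. R k j (s i k f)))"
proof -
  let ?x = "so_basis i j"
  let ?b1 = "\<lambda>x y. (sg i * trl i y) *\<^sub>R pd j" and ?b2 = "\<lambda>x y. (- sg j * trl j y) *\<^sub>R pd i"
  let ?b3 = "\<lambda>x y. (\<Sum>k\<in>I. rot k i y *\<^sub>R so_basis k j)" and ?b4 = "\<lambda>x y. (\<Sum>k\<in>I. rot k j y *\<^sub>R so_basis i k)"
  note m = alt_mlin[OF assms(1)]
  have "lieD brh ?x f = lieD (\<lambda>x y. ?b1 x y + ?b2 x y) ?x f + lieD (\<lambda>x y. ?b3 x y + ?b4 x y) ?x f"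
    by (rule lieD_add_bracket[where br = brh, OF m]) (rule brh_so_basis[OF assms(2,3)])
  also have "lieD (\<lambda>x y. ?b1 x y + ?b2 x y) ?x f = lieD ?b1 ?x f + lieD ?b2 ?x f"
    by (rule lieD_add_bracket[of f "\<lambda>x y. ?b1 x y + ?b2 x y" ?x ?b1 ?b2, OF m]) (rule refl)
  also have "lieD (\<lambda>x y. ?b3 x y + ?b4 x y) ?x f = lieD ?b3 ?x f + lieD ?b4 ?x f"
    by (rule lieD_add_bracket[of f "\<lambda>x y. ?b3 x y + ?b4 x y" ?x ?b3 ?b4, OF m]) (rule refl)
  also have "lieD ?b1 ?x f = - sg i *\<^sub>R E i (c j f)"
    using lieD_eq_wedge_ctr[OF assms(1), of ?b1 ?x "\<lambda>_ y. sg i * trl i y" "\<lambda>_. pd j" "{()}"]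
    by (simp add: wedge_scale_form)
  also have "lieD ?b2 ?x f = sg j *\<^sub>R E j (c i f)"
    using lieD_eq_wedge_ctr[OF assms(1), of ?b2 ?x "\<lambda>_ y. - sg j * trl j y" "\<lambda>_. pd i" "{()}"]
      wedge_scale_form[of "- sg j" "trl j"]
    by simp
  also have "lieD ?b3 ?x f = - (\<Sum>k\<in>I. R k i (s k j f))"
    by (rule lieD_eq_wedge_ctr[of f ?b3 ?x "\<lambda>k. rot k i" "\<lambda>k. so_basis k j" I, OF assms(1)]) (rule refl)
  also have "lieD ?b4 ?x f = - (\<Sum>k\<in>I. R k j (s i k f))"
    by (rule lieD_eq_wedge_ctr[of f ?b4 ?x "\<lambda>k. rot k j" "\<lambda>k. so_basis i k" I, OF assms(1)]) (rule refl)
  finally show ?thesis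
    by (simp only: scaleR_minus_left diff_conv_add_uminus minus_add_distrib ac_simps)
qed

lemma d_E: "d (E i f) = (\<Sum>m\<in>I. R i m (E m f)) - E i (d f)"
  by (rule brh.ced_wedge) (rule trl_brh)

text \<open>The Leibniz rule for \<open>E i\<close> and Cartan's formula for the two contractions
  produce \<open>E i (d (c j (s i j f)))\<close> with opposite signs. What survives is the structure
  equation of \<open>trl i\<close> and the Lie derivatives along \<open>pd j\<close> and
  \<open>so_basis i j\<close>. The diagonal case, where \<open>so_basis i i\<close> is 0, is kept so
  that the later sums stay uniform.\<close>

lemma homotopy_term:
  assumes "alt f" "i \<in> I" "j \<in> I"
  shows "d (E i (c j (s i j f))) + E i (c j (s i j (d f))) =
    (\<Sum>m\<in>I. R i m (E m (c j (s i j f)))) - (\<Sum>m\<in>I. R m j (E i (c m (s i j f))))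
    + sg j *\<^sub>R E i (c i f) - sg j *\<^sub>R E i (E j (c j (c i f))) - (if i = j then sg i *\<^sub>R E i (c i f) else 0)
    - (\<Sum>k\<in>I. R k i (E i (c j (s k j f)))) - (\<Sum>k\<in>I. R k j (E i (c j (s i k f))))"
proof -
  have RE: "E i (R a b g) = - R a b (E i g)" for a b g by (rule wedge_wedge)
  have EE: "E i (E i g) = 0" for g
  proof -
    have "E i (E i g) + E i (E i g) = 0" using wedge_wedge[of "trl i" "trl i" g] by (metis add.left_inverse)
    then have "2 *\<^sub>R E i (E i g) = 0" by (simp only: scaleR_2)
    then show ?thesis by simp
  qed
  have 1: "E i (lieD brh (pd j) (s i j f)) = (\<Sum>m\<in>I. R m j (E i (c m (s i j f))))"
    unfolding lieD_pd[OF alt_ctr[OF assms(1)] assms(3)]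
    by (simp only: wedge_simps RE sum_negf minus_minus)
  have 2: "E i (c j (lieD brh (so_basis i j) f)) =
    sg j *\<^sub>R E i (c i f) - sg j *\<^sub>R E i (E j (c j (c i f))) - (if i = j then sg i *\<^sub>R E i (c i f) else 0)
    - (\<Sum>k\<in>I. R k i (E i (c j (s k j f)))) - (\<Sum>k\<in>I. R k j (E i (c j (s i k f))))"
  proof -
    have "c j (lieD brh (so_basis i j) f) =
      sg j *\<^sub>R (c i f - E j (c j (c i f))) - sg i *\<^sub>R ((if i = j then c j f else 0) - E i (c j (c j f)))
      + (\<Sum>k\<in>I. R k i (c j (s k j f))) + (\<Sum>k\<in>I. R k j (c j (s i k f)))"
      unfolding lieD_so_basis[OF assms]
      by (simp only: ctr_simps c_E c_R sum_negf if_True) (simp add: algebra_simps)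
    then show ?thesis
      by (simp only: ctr_ctr_same[OF assms(1)] wedge_simps RE EE sum_negf) (simp add: algebra_simps wedge_simps)
  qed
  have "c j (s i j (d f)) = c j (lieD brh (so_basis i j) f) - lieD brh (pd j) (s i j f) + d (c j (s i j f))"
    by (simp add: ctr_ced ctr_simps)
  then have "E i (c j (s i j (d f))) = E i (c j (lieD brh (so_basis i j) f)) - E i (lieD brh (pd j) (s i j f)) + E i (d (c j (s i j f)))"
    by (simp only: wedge_simps)
  then show ?thesis unfolding d_E 1 2 by (simp add: algebra_simps)
qed

text \<open>Normal ordering: moving \<open>c i\<close> past \<open>E j\<close> costs a diagonal
  term, and these terms sum to \<open>number_op f\<close>.\<close>

lemma number_op_sq:
  assumes "alt f"
  shows "number_op (number_op f) = number_op f + (\<Sum>i\<in>I. \<Sum>j\<in>I. E i (E j (c j (c i f))))"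
proof -
  have 1: "E i (c i (E j (c j f))) = (if j = i then E i (c i f) else 0) + E i (E j (c j (c i f)))" for i j
    unfolding c_E wedge_simps ctr_ctr[OF assms, of "pd i" "pd j"]
    by (cases "j = i") (simp_all add: wedge_simps)
  have "number_op (number_op f) = (\<Sum>i\<in>I. \<Sum>j\<in>I. E i (c i (E j (c j f))))"
    unfolding number_op_def ctr_simps wedge_simps ..
  also have "\<dots> = (\<Sum>i\<in>I. \<Sum>j\<in>I. (if j = i then E i (c i f) else 0)) + (\<Sum>i\<in>I. \<Sum>j\<in>I. E i (E j (c j (c i f))))"
    unfolding 1 sum.distrib ..
  also have "(\<Sum>i\<in>I. \<Sum>j\<in>I. (if j = i then E i (c i f) else 0)) = number_op f"
    unfolding number_op_def by (rule sum.cong[OF refl]) (simp only: sum.delta finite_atLeastAtMost if_True)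
  finally show ?thesis .
qed

text \<open>The Casimir element of the rotation algebra, acting on the translation factor only, is
  null-homotopic; it acts as the scalar \<open>b (n - b)\<close> on forms with \<open>b\<close> translation arguments.\<close>

theorem homotopy_formula:
  assumes "alt f"
  shows "d (homotopy f) + homotopy (d f) = real (p + q) *\<^sub>R number_op f - number_op (number_op f)"
proof -
  let ?G = "\<lambda>a b e g k l. R a b (E e (c g (s k l f)))"
  let ?S = "\<lambda>F. \<Sum>i\<in>I. \<Sum>j\<in>I. \<Sum>m\<in>I. F i j m"
  have "d (homotopy f) + homotopy (d f) =
    (\<Sum>i\<in>I. \<Sum>j\<in>I. sg j *\<^sub>R (d (E i (c j (s i j f))) + E i (c j (s i j (d f)))))"
    unfolding homotopy_def ced_simps by (simp only: scaleR_add_right sum.distrib)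
  \<comment> \<open>In the terms without \<open>R\<close> the two metric signs multiply to 1. The
    summand \<open>E i (c i f)\<close> then no longer depends on \<open>j\<close>, and its sum over
    \<open>j\<close> is the origin of the factor \<open>p + q\<close>.\<close>
  also have "\<dots> = (\<Sum>i\<in>I. \<Sum>j\<in>I.
    (\<Sum>m\<in>I. sg j *\<^sub>R ?G i m m j i j) - (\<Sum>m\<in>I. sg j *\<^sub>R ?G m j i m i j)
    + E i (c i f) - E i (E j (c j (c i f))) - (if j = i then E i (c i f) else 0)
    - (\<Sum>m\<in>I. sg j *\<^sub>R ?G m i i j m j) - (\<Sum>m\<in>I. sg j *\<^sub>R ?G m j i j i m))"
    by (intro sum.cong refl) (auto simp: homotopy_term[OF assms] scaleR_add_right scaleR_diff_right scaleR_sum_right simp del: atLeastAtMost_iff)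
  also have "\<dots> = ?S (\<lambda>i j m. sg j *\<^sub>R ?G i m m j i j) - ?S (\<lambda>i j m. sg j *\<^sub>R ?G m j i m i j)
    + real (p + q) *\<^sub>R number_op f - (\<Sum>i\<in>I. \<Sum>j\<in>I. E i (E j (c j (c i f)))) - number_op f
    - ?S (\<lambda>i j m. sg j *\<^sub>R ?G m i i j m j) - ?S (\<lambda>i j m. sg j *\<^sub>R ?G m j i j i m)"
  proof -
    have "(\<Sum>i\<in>I. \<Sum>j\<in>I. (if j = i then E i (c i f) else 0)) = number_op f"
      unfolding number_op_def by (rule sum.cong[OF refl]) (simp only: sum.delta finite_atLeastAtMost if_True)
    moreover have "(\<Sum>i\<in>I. \<Sum>j\<in>I. E i (c i f)) = real (p + q) *\<^sub>R number_op f"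
      unfolding number_op_def scaleR_sum_right by (simp only: sum_constant_scaleR card_atLeastAtMost diff_Suc_1)
    ultimately show ?thesis
      by (simp only: sum.distrib sum_subtractf)
  qed
  \<comment> \<open>The structure equation cancels against one half of the adjoint action: the two
    sums agree after exchanging the names \<open>i\<close> and \<open>m\<close>.\<close>
  also have "?S (\<lambda>i j m. sg j *\<^sub>R ?G m i i j m j) = ?S (\<lambda>i j m. sg j *\<^sub>R ?G i m m j i j)"
  proof -
    have "?S (\<lambda>i j m. sg j *\<^sub>R ?G m i i j m j) = (\<Sum>j\<in>I. \<Sum>i\<in>I. \<Sum>m\<in>I. sg j *\<^sub>R ?G m i i j m j)"
      by (rule sum.swap)
    also have "\<dots> = (\<Sum>j\<in>I. \<Sum>m\<in>I. \<Sum>i\<in>I. sg j *\<^sub>R ?G m i i j m j)"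
      by (rule sum.cong[OF refl], rule sum.swap)
    also have "\<dots> = ?S (\<lambda>i j m. sg j *\<^sub>R ?G i m m j i j)"
      by (rule sum.swap)
    finally show ?thesis .
  qed
  \<comment> \<open>The Lie derivative along the translation cancels the other half, by skewness of
    \<open>rot\<close> and the exchange of \<open>j\<close> and \<open>m\<close>.\<close>
  also have "?S (\<lambda>i j m. sg j *\<^sub>R ?G m j i m i j) = - ?S (\<lambda>i j m. sg j *\<^sub>R ?G m j i j i m)"
  proof -
    have "sg j *\<^sub>R R m j g = - (sg m *\<^sub>R R j m g)" for j m g
    proof -
      have "(\<lambda>v. sg j * rot m j v) = (\<lambda>v. (- sg m) * rot j m v)"
        using rot_skew'[of j m] by (simp add: fun_eq_iff)
      then have "wedge (\<lambda>v. sg j * rot m j v) g = wedge (\<lambda>v. (- sg m) * rot j m v) g" by (rule arg_cong)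
      then show ?thesis unfolding wedge_scale_form by (simp only: scaleR_minus_left)
    qed
    then have "?S (\<lambda>i j m. sg j *\<^sub>R ?G m j i m i j) = ?S (\<lambda>i j m. - (sg m *\<^sub>R ?G j m i m i j))"
      by (intro sum.cong refl)
    also have "\<dots> = - ?S (\<lambda>i j m. sg m *\<^sub>R ?G j m i m i j)" by (simp only: sum_negf)
    also have "?S (\<lambda>i j m. sg m *\<^sub>R ?G j m i m i j) = ?S (\<lambda>i j m. sg j *\<^sub>R ?G m j i j i m)"
      by (rule sum.cong[OF refl], rule sum.swap)
    finally show ?thesis .
  qed
  finally have *: "d (homotopy f) + homotopy (d f) =
    ?S (\<lambda>i j m. sg j *\<^sub>R ?G i m m j i j) - (- ?S (\<lambda>i j m. sg j *\<^sub>R ?G m j i j i m))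
    + real (p + q) *\<^sub>R number_op f - (\<Sum>i\<in>I. \<Sum>j\<in>I. E i (E j (c j (c i f)))) - number_op f
    - ?S (\<lambda>i j m. sg j *\<^sub>R ?G i m m j i j) - ?S (\<lambda>i j m. sg j *\<^sub>R ?G m j i j i m)" .
  have "A - (- B) + X - Q - N - A - B = X - (N + Q)" for A B X Q N :: "vf list \<Rightarrow> real"
    by (simp add: fun_eq_iff)
  then show ?thesis unfolding number_op_sq[OF assms] * .
qed

end

subsection \<open>Forms of fixed degree\<close>

text \<open>A form on the range of a projection \<open>P\<close> is represented by its pullback along \<open>P\<close>, so that no
  membership conditions on arguments occur.\<close>

definition forms :: "('v::real_vector \<Rightarrow> 'v) \<Rightarrow> nat \<Rightarrow> ('v list \<Rightarrow> real) set" where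
  "forms P k = {f. alt f \<and> (\<forall>xs. f (map P xs) = f xs) \<and> (\<forall>xs. length xs \<noteq> k \<longrightarrow> f xs = 0)}"

lemma formsD:
  assumes "f \<in> forms P k"
  shows "alt f" "f (map P xs) = f xs" "length xs \<noteq> k \<Longrightarrow> f xs = 0"
  using assms by (auto simp: forms_def)

lemma subspace_forms: "subspace (forms P k)"
proof -
  have "alt 0" "\<And>f g. alt f \<Longrightarrow> alt g \<Longrightarrow> alt (f + g)" "\<And>c f. alt f \<Longrightarrow> alt (c *\<^sub>R f)"
    using subspace_alt by (auto simp: subspace_def)
  then show ?thesis by (auto simp: subspace_def forms_def)
qed

lemma map_inv_ctr:
  assumes "\<And>x. P (P x) = P x" "\<And>xs. f (map P xs) = f xs"
  shows "ctr x f (map P xs) = ctr x f xs" "ctr (P x) f = ctr x f"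
proof -
  have PP: "map P (map P zs) = map P zs" for zs by (simp add: assms(1))
  have "f (x # map P xs) = f (map P (x # map P xs))" by (rule assms(2)[symmetric])
  also have "\<dots> = f (map P (x # xs))" by (simp add: assms(1) o_def)
  finally show "ctr x f (map P xs) = ctr x f xs" unfolding ctr_def assms(2) .
  have "f (P x # ys) = f (x # ys)" for ys
  proof -
    have "f (P x # ys) = f (map P (P x # ys))" by (rule assms(2)[symmetric])
    also have "\<dots> = f (map P (x # ys))" by (simp add: assms(1))
    finally show ?thesis unfolding assms(2) .
  qed
  then show "ctr (P x) f = ctr x f" by (simp add: ctr_def fun_eq_iff)
qed

lemma ctr_forms:
  assumes "\<And>x. P (P x) = P x" "f \<in> forms P (Suc k)"
  shows "ctr x f \<in> forms P k"
  using map_inv_ctr(1)[of P f, OF assms(1)] alt_ctr formsD[OF assms(2)]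
  by (auto simp: forms_def) (simp add: ctr_def)

lemma ctr_forms_0: "f \<in> forms P 0 \<Longrightarrow> ctr x f = 0"
  by (auto simp: forms_def ctr_def fun_eq_iff)

lemma wedge_forms:
  assumes "\<And>x. P (P x) = P x" "linear l" "\<And>x. l (P x) = l x" "f \<in> forms P k"
  shows "wedge l f \<in> forms P (Suc k)"
proof -
  have "wedge l f (map P xs) = wedge l f xs" if "\<And>xs. f (map P xs) = f xs" for xs
    using that
  proof (induction xs arbitrary: f)
    case (Cons x xs)
    have "wedge l (ctr x f) (map P xs) = wedge l (ctr x f) xs"
      by (rule Cons.IH) (rule map_inv_ctr(1)[of P f, OF assms(1) Cons.prems])
    then show ?case
      using map_inv_ctr(2)[of P f, OF assms(1) Cons.prems] by (simp add: assms(3) Cons.prems)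
  qed simp
  moreover have "wedge l f xs = 0" if "length xs \<noteq> Suc k" "\<And>xs. length xs \<noteq> k \<Longrightarrow> f xs = 0" for xs
    using that
  proof (induction xs arbitrary: f k)
    case (Cons x xs)
    show ?case
    proof (cases k)
      case 0
      then have "ctr x f = 0" using Cons.prems(2) by (auto simp: ctr_def fun_eq_iff)
      then show ?thesis using Cons.prems 0 by (simp add: wedge_simps)
    next
      case (Suc m)
      have "wedge l (ctr x f) xs = 0"
        by (rule Cons.IH[of m]) (use Cons.prems Suc in \<open>auto simp: ctr_def\<close>)
      then show ?thesis using Cons.prems by simp
    qed
  qed simp
  ultimately show ?thesis using alt_wedge[OF assms(2)] assms(4) by (simp add: forms_def)
qed

lemma lieD_degree:
  assumes "\<And>xs. length xs \<noteq> k \<Longrightarrow> f xs = 0" "length xs \<noteq> k"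
  shows "lieD br x f xs = 0"
  using assms
proof (induction xs arbitrary: f k)
  case (Cons y ys)
  show ?case
  proof (cases k)
    case 0
    then have "ctr y f = 0" using Cons.prems(1) by (auto simp: ctr_def fun_eq_iff)
    then show ?thesis using Cons.prems by (simp add: lieD_simps)
  next
    case (Suc m)
    have "lieD br x (ctr y f) ys = 0"
      by (rule Cons.IH[of m]) (use Cons.prems Suc in \<open>auto simp: ctr_def\<close>)
    then show ?thesis using Cons.prems by simp
  qed
qed simp

lemma ced_degree:
  assumes "\<And>xs. length xs \<noteq> k \<Longrightarrow> f xs = 0" "length xs \<noteq> Suc k"
  shows "ced br f xs = 0"
  using assms
proof (induction xs arbitrary: f k)
  case (Cons y ys)
  have 1: "lieD br y f ys = 0" by (rule lieD_degree[of k]) (use Cons.prems in auto)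
  show ?case
  proof (cases k)
    case 0
    then have "ctr y f = 0" using Cons.prems(1) by (auto simp: ctr_def fun_eq_iff)
    then show ?thesis using 1 by (simp add: ced_simps)
  next
    case (Suc m)
    have "ced br (ctr y f) ys = 0"
      by (rule Cons.IH[of m]) (use Cons.prems Suc in \<open>auto simp: ctr_def\<close>)
    then show ?thesis using 1 by simp
  qed
qed simp

lemma (in lie_bracket) ced_forms:
  assumes "\<And>x y. br (P x) (P y) = P (br x y)" "f \<in> forms P k"
  shows "ced br f \<in> forms P (Suc k)"
proof -
  have "(\<lambda>zs. f (map P zs)) = f" using formsD(2)[OF assms(2)] by (rule ext)
  then have "ced br f (map P xs) = ced br f xs" for xs
    using ced_map[of br P br f xs, OF assms(1)] by simp
  then show ?thesis
    using alt_ced formsD[OF assms(2)] ced_degree[of k f] by (simp add: forms_def)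
qed

text \<open>Multilinearity, applied one argument at a time. \<open>G\<close> may be infinite:
  besides a finite spanning set, it will also be the set of all rotations together with the basis
  translations.\<close>

lemma forms_vanish:
  assumes "\<And>x. P (P x) = P x" "\<And>x. P x \<in> span G"
    and "mlin f" "\<And>xs. f (map P xs) = f xs"
    and "\<And>ys. ys \<in> lists G \<Longrightarrow> length ys = length xs \<Longrightarrow> f ys = 0"
  shows "f xs = 0"
  using assms(3-5)
proof (induction xs arbitrary: f)
  case (Cons x xs)
  have "ctr x f xs = 0"
  proof (rule Cons.IH)
    show "mlin (ctr x f)" by (rule mlin_ctr[OF Cons.prems(1)])
    show "ctr x f (map P ys) = ctr x f ys" for ys
      by (rule map_inv_ctr(1)[of P f, OF assms(1) Cons.prems(2)])
    fix ys assume ys: "ys \<in> lists G" "length ys = length xs"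
    have lin: "linear (\<lambda>v. f (v # ys))" using mlin_arg[OF Cons.prems(1), of "[]" ys] by simp
    have "subspace {v. f (v # ys) = 0}"
      using linear_0[OF lin] linear_add[OF lin] linear_scale[OF lin] by (auto simp: subspace_def)
    moreover have "G \<subseteq> {v. f (v # ys) = 0}" using Cons.prems(3)[of "_ # ys"] ys by simp blast
    ultimately have "f (P x # ys) = 0" using assms(2)[of x] span_minimal by blast
    then show "ctr x f ys = 0"
      using map_inv_ctr(2)[of P f, OF assms(1) Cons.prems(2)] by (metis ctr_def)
  qed
  then show ?case by (simp add: ctr_def)
qed simp

lemma fin_dim_forms:
  assumes "\<And>x. P (P x) = P x" "\<And>x. P x \<in> span G" "finite G"
  shows "fin_dim (forms P k)"
proof (rule fin_dim_of_determining[OF _ subspace_forms])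
  show "finite {ys. set ys \<subseteq> G \<and> length ys = k}" by (rule finite_lists_length_eq[OF assms(3)])
  fix f assume f: "f \<in> forms P k" and z: "\<And>ys. ys \<in> {ys. set ys \<subseteq> G \<and> length ys = k} \<Longrightarrow> f ys = 0"
  have "f xs = 0" for xs
  proof (cases "length xs = k")
    case True
    show ?thesis
      by (rule forms_vanish[of P G, OF assms(1,2) alt_mlin]) (use True z formsD[OF f] in auto)
  qed (use formsD(3)[OF f] in auto)
  then show "f = 0" by auto
qed

text \<open>The entries of \<open>ds\<close> are moved to the front one after the other. The sign is
  left open, since the application only asks whether the value is 0.\<close>

lemma alt_bring_front:
  assumes "alt f" "distinct ds" "set ds \<subseteq> set xs"
  shows "\<exists>ys. mset xs = mset (ds @ ys) \<and> (f xs = f (ds @ ys) \<or> f xs = - f (ds @ ys))"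
  using assms
proof (induction ds arbitrary: f xs)
  case (Cons x ds)
  then obtain as bs where xs: "xs = as @ x # bs" using split_list by (metis list.set_intros(1) subsetD)
  have "f xs = (-1) ^ length as * ctr x f (as @ bs)"
    unfolding xs ctr_def by (rule alt_move_front[OF Cons.prems(1)])
  then have 1: "f xs = ctr x f (as @ bs) \<or> f xs = - ctr x f (as @ bs)"
    by (cases "even (length as)") simp_all
  have "set ds \<subseteq> set (as @ bs)" using Cons.prems xs by auto
  then obtain ys where "mset (as @ bs) = mset (ds @ ys)"
    "ctr x f (as @ bs) = ctr x f (ds @ ys) \<or> ctr x f (as @ bs) = - ctr x f (ds @ ys)"
    using Cons.IH[OF alt_ctr[OF Cons.prems(1)], of "as @ bs"] Cons.prems(2) by auto
  then show ?case using 1 xs by (intro exI[of _ ys]) (auto simp: ctr_def)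
qed auto

section \<open>Restriction, top coefficient and the spectrum of the counting operator\<close>

context pseudo_euclidean
begin

abbreviation rot_gens :: "vf set" where "rot_gens \<equiv> (\<lambda>(i, j). so_basis i j) ` (I \<times> I)"

lemma Pso_decomp: "Pso v = (\<Sum>i\<in>I. \<Sum>j\<in>I. (rot i j v * sg j / 2) *\<^sub>R so_basis i j)"
  using Ph_decomp[of "Pso v"] by (simp add: rot_def)

lemma Ph_eq: "Ph v = Pso v + (\<Sum>i\<in>I. trl i v *\<^sub>R pd i)"
  unfolding Ph_decomp Pso_decomp ..

lemma Pso_in_span: "Pso v \<in> span rot_gens"
  unfolding Pso_decomp by (intro span_sum span_scale span_base) auto

lemma Ph_in_span: "Ph v \<in> span (rot_gens \<union> pd ` I)"
  unfolding Ph_eq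
proof (rule span_add)
  show "Pso v \<in> span (rot_gens \<union> pd ` I)" using Pso_in_span span_mono by blast
  show "(\<Sum>i\<in>I. trl i v *\<^sub>R pd i) \<in> span (rot_gens \<union> pd ` I)"
    by (intro span_sum span_scale span_base) auto
qed

lemma fin_dim_forms_Ph: "fin_dim (forms Ph k)"
  by (rule fin_dim_forms[OF Ph_Ph Ph_in_span]) simp

text \<open>Inflation along the quotient map by the translations becomes an inclusion of sets,
  because \<open>Pso\<close> absorbs \<open>Ph\<close>.\<close>

lemma forms_Pso_subset: "forms Pso k \<subseteq> forms Ph k"
proof
  fix f assume f: "f \<in> forms Pso k"
  have "f (map Ph xs) = f xs" for xs
    using formsD(2)[OF f, of "map Ph xs"] formsD(2)[OF f, of xs] by (simp add: o_def)
  then show "f \<in> forms Ph k" using f by (simp add: forms_def)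
qed

lemma d_forms: "f \<in> forms Ph k \<Longrightarrow> d f \<in> forms Ph (Suc k)"
  by (rule brh.ced_forms) (simp_all add: brh_def brh_Ph)

lemma ced_brs_forms: "f \<in> forms Pso k \<Longrightarrow> ced brs f \<in> forms Pso (Suc k)"
  by (rule brs.ced_forms) (simp_all add: brs_def brs_Pso)

lemma c_forms: "f \<in> forms Ph (Suc k) \<Longrightarrow> ctr x f \<in> forms Ph k"
  by (rule ctr_forms[OF Ph_Ph])

lemma E_forms: "i \<in> I \<Longrightarrow> f \<in> forms Ph k \<Longrightarrow> E i f \<in> forms Ph (Suc k)"
  by (rule wedge_forms[OF Ph_Ph linear_trl trl_Ph])

lemma number_op_forms:
  assumes "f \<in> forms Ph k"
  shows "number_op f \<in> forms Ph k"
proof (cases k)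
  case 0
  then have "number_op f = 0"
    using assms ctr_forms_0[of f Ph] by (simp add: number_op_def wedge_simps)
  then show ?thesis using subspace_0[OF subspace_forms] by metis
next
  case (Suc m)
  then show ?thesis unfolding number_op_def
    using assms by (auto intro!: subspace_sum[OF subspace_forms] E_forms c_forms simp del: atLeastAtMost_iff)
qed

lemma homotopy_forms:
  assumes "f \<in> forms Ph (Suc k)"
  shows "homotopy f \<in> forms Ph k"
proof (cases k)
  case 0
  have "c j (s i j f) = 0" for i j
    using ctr_forms_0[OF c_forms[of f 0]] assms 0 by simp
  then have "homotopy f = 0" by (simp add: homotopy_def wedge_simps)
  then show ?thesis using subspace_0[OF subspace_forms] by metis
next
  case (Suc m)
  have "sg j *\<^sub>R E i (c j (s i j f)) \<in> forms Ph k" if "i \<in> I" for i j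
    unfolding Suc
    by (rule subspace_scale[OF subspace_forms], rule E_forms[OF that], rule c_forms, rule c_forms)
      (use assms Suc in simp)
  then show ?thesis unfolding homotopy_def
    by (intro subspace_sum[OF subspace_forms])
qed

lemma homotopy_forms_0: "f \<in> forms Ph 0 \<Longrightarrow> homotopy f = 0"
  by (simp add: homotopy_def ctr_forms_0 ctr_simps wedge_simps)

definition is_pd :: "vf \<Rightarrow> bool" where
  "is_pd x \<longleftrightarrow> x \<in> pd ` I"

lemma pd_inj: "pd i = pd j \<longleftrightarrow> i = j"
  by (metis trl_pd zero_neq_one)

lemma is_pd_not_Pso: "is_pd x \<Longrightarrow> Pso x \<noteq> x"
  unfolding is_pd_def using trl_pd trl_Pso by (metis Pso_pd imageE zero_neq_one)

text \<open>Commuting the contraction with \<open>x\<close> past \<open>number_op\<close> costs the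
  sum of the \<open>c i f\<close> weighted by \<open>trl i x\<close>. This is \<open>ctr x f\<close>
  if \<open>x\<close> is a basis translation and 0 if \<open>x\<close> is a rotation, so each
  translation in the list adds one.\<close>

lemma number_op_eval:
  assumes "alt f" "\<And>x. x \<in> set xs \<Longrightarrow> Pso x = x \<or> is_pd x"
  shows "number_op f xs = real (length (filter is_pd xs)) * f xs"
  using assms
proof (induction xs arbitrary: f)
  case Nil
  then show ?case by (simp add: number_op_def sum_fun_apply)
next
  case (Cons x xs)
  have 0: "ctr x (number_op f) = (\<Sum>i\<in>I. trl i x *\<^sub>R c i f) + number_op (ctr x f)"
    unfolding number_op_def ctr_simps ctr_wedge sum_subtractf ctr_ctr[OF Cons.prems(1), of x] wedge_simps
    by (simp only: sum_negf diff_minus_eq_add)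
  have "number_op f (x # xs) = ctr x (number_op f) xs" by (simp add: ctr_def)
  then have 1: "number_op f (x # xs) = (\<Sum>i\<in>I. trl i x *\<^sub>R c i f) xs + number_op (ctr x f) xs"
    unfolding 0 plus_fun_apply .
  have IH: "number_op (ctr x f) xs = real (length (filter is_pd xs)) * f (x # xs)"
    using Cons.IH[OF alt_ctr[OF Cons.prems(1), of x]] Cons.prems(2) by (simp add: ctr_def[of x f xs])
  show ?case
  proof (cases "is_pd x")
    case True
    then obtain j where j: "j \<in> I" "x = pd j" unfolding is_pd_def by blast
    have "(\<Sum>i\<in>I. trl i x *\<^sub>R c i f) = (\<Sum>i\<in>I. if i = j then c i f else 0)"
      by (intro sum.cong refl) (simp add: j trl_pd)
    also have "\<dots> = c j f" using j(1) by (simp only: sum.delta finite_atLeastAtMost if_True)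
    finally show ?thesis using 1 IH True j by (simp add: ctr_def algebra_simps)
  next
    case False
    then have "Pso x = x" using Cons.prems(2)[of x] by simp
    then have "trl i x = 0" for i by (metis trl_Pso)
    then show ?thesis using 1 IH False by simp
  qed
qed

abbreviation pds :: "vf list" where "pds \<equiv> map pd [1..<Suc (p + q)]"

lemma set_pds: "set pds = pd ` I"
  by (simp add: atLeastLessThanSuc_atLeastAtMost del: upt_Suc)

lemma length_pds: "length pds = p + q"
  by (simp del: upt_Suc)

lemma distinct_pds: "distinct pds"
  by (simp add: distinct_map inj_on_def pd_inj del: upt_Suc)

definition res :: "(vf list \<Rightarrow> real) \<Rightarrow> vf list \<Rightarrow> real" where
  "res f xs = f (map Pso xs)"

definition top_coeff :: "(vf list \<Rightarrow> real) \<Rightarrow> vf list \<Rightarrow> real" where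
  "top_coeff f xs = f (pds @ map Pso xs)"

text \<open>On a list of rotations and basis translations \<open>number_op\<close> counts the translations, so a form
  killed by \<open>casimir\<close> lives on lists with no translation (seen by \<open>res\<close>) or with all \<open>n\<close> of them (seen
  by \<open>top_coeff\<close>).\<close>

definition casimir :: "(vf list \<Rightarrow> real) \<Rightarrow> vf list \<Rightarrow> real" where
  "casimir f = real (p + q) *\<^sub>R number_op f - number_op (number_op f)"

lemma casimir_injective:
  assumes f: "f \<in> forms Ph k" and "casimir f = 0" "res f = 0" "top_coeff f = 0"
  shows "f = 0"
proof -
  let ?cnt = "\<lambda>xs. length (filter is_pd xs)"
  have a: "alt f" using formsD(1)[OF f] .
  have aN: "alt (number_op f)" using formsD(1)[OF number_op_forms[OF f]] .
  have van: "f xs = 0" if xs: "xs \<in> lists {x. Pso x = x \<or> is_pd x}" for xs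
  proof (rule ccontr)
    assume nz: "f xs \<noteq> 0"
    have pure: "Pso x = x \<or> is_pd x" if "x \<in> set xs" for x using xs that by auto
    have "casimir f xs = 0" using assms(2) by simp
    then have "real (p + q) * (real (?cnt xs) * f xs) - real (?cnt xs) * (real (?cnt xs) * f xs) = 0"
      by (simp add: casimir_def number_op_eval[OF a pure] number_op_eval[OF aN pure])
    \<comment> \<open>This is where the eigenvalue \<open>b (n - b)\<close> appears, with
      \<open>b\<close> the number of translations in \<open>xs\<close>.\<close>
    then have "real (?cnt xs) * (real (p + q) - real (?cnt xs)) * f xs = 0"
      by (simp add: algebra_simps)
    then have "real (?cnt xs) = 0 \<or> real (p + q) = real (?cnt xs)" using nz by simp
    then have "?cnt xs = 0 \<or> ?cnt xs = p + q" by linarith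
    then show False
    proof
      assume "?cnt xs = 0"
      then have "map Pso xs = xs" using pure by (auto simp: filter_empty_conv intro: map_idI)
      then have "res f xs = f xs" by (simp add: res_def)
      then show False using assms(3) nz by simp
    next
      assume n: "?cnt xs = p + q"
      \<comment> \<open>A nonzero value forbids repetitions, so \<open>p + q\<close> translations in
        \<open>xs\<close> must be all of \<open>pds\<close>, each occurring once.\<close>
      have dist: "distinct xs" using alt_repeated[OF a] nz by blast
      have "set (filter is_pd xs) \<subseteq> set pds" unfolding set_pds by (auto simp: is_pd_def)
      moreover have "card (set (filter is_pd xs)) = card (set pds)"
        using n distinct_card[of "filter is_pd xs"] distinct_card[OF distinct_pds] dist length_pds by simp
      ultimately have "set (filter is_pd xs) = set pds" by (intro card_subset_eq) auto
      then have "set pds \<subseteq> set xs" by (metis filter_is_subset)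
      then obtain ys where ys: "mset xs = mset (pds @ ys)" "f xs = f (pds @ ys) \<or> f xs = - f (pds @ ys)"
        using alt_bring_front[OF a distinct_pds] by blast
      have "?cnt xs = ?cnt (pds @ ys)" using ys(1) by (metis mset_filter size_mset)
      moreover have "filter is_pd pds = pds" using set_pds by (intro filter_True) (auto simp: is_pd_def)
      ultimately have "?cnt ys = 0" using n length_pds by (simp only: filter_append length_append)
      moreover have "set ys \<subseteq> set xs" using ys(1) by (metis set_append set_mset_mset Un_upper2)
      ultimately have "map Pso ys = ys" using pure by (auto simp: filter_empty_conv intro!: map_idI)
      then have "f (pds @ ys) = top_coeff f ys" by (simp add: top_coeff_def)
      then show False using ys(2) nz assms(4) by simp
    qed
  qed
  have "f xs = 0" for xs
  proof (rule forms_vanish[where P = Ph and G = "{x. Pso x = x \<or> is_pd x}"])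
    show "Ph x \<in> span {x. Pso x = x \<or> is_pd x}" for x
      unfolding Ph_eq
      by (intro span_add span_sum span_scale span_base) (auto simp: is_pd_def)
  qed (use van formsD[OF f] alt_mlin in auto)
  then show ?thesis by auto
qed

end

lemma dim_mono_fin_dim:
  assumes "fin_dim V" "W \<subseteq> V"
  shows "dim W \<le> dim V"
proof -
  obtain B where B: "B \<subseteq> V" "independent B" "V \<subseteq> span B" "card B = dim V"
    using basis_exists by blast
  have "finite B" using fin_dim_basis assms(1) B by blast
  then have "dim W \<le> card B" using B(3) assms(2) by (intro dim_le_card) auto
  then show ?thesis using B(4) by simp
qed

lemma alt_map:
  assumes "linear P" "alt f"
  shows "alt (\<lambda>xs. f (map P xs))"
proof -
  have "linear (\<lambda>x. f (map P ys @ P x # map P zs))" for ys zs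
    using linear_compose[OF assms(1) mlin_arg[OF alt_mlin[OF assms(2)]]] by (simp add: o_def)
  then show ?thesis using assms(2) by (simp add: alt_def mlin_def)
qed

lemma alt_append: "alt f \<Longrightarrow> alt (\<lambda>xs. f (ds @ xs))"
proof (induction ds arbitrary: f)
  case (Cons x ds)
  show ?case using Cons.IH[OF alt_ctr[OF Cons.prems, of x]] by (simp add: ctr_def)
qed simp

subsection \<open>Dimension count\<close>

definition cocycle_forms :: "('v::real_vector \<Rightarrow> 'v \<Rightarrow> 'v) \<Rightarrow> ('v \<Rightarrow> 'v) \<Rightarrow> nat \<Rightarrow> ('v list \<Rightarrow> real) set" where
  "cocycle_forms br P k = {f \<in> forms P k. ced br f = 0}"

definition coboundary_forms :: "('v::real_vector \<Rightarrow> 'v \<Rightarrow> 'v) \<Rightarrow> ('v \<Rightarrow> 'v) \<Rightarrow> nat \<Rightarrow> ('v list \<Rightarrow> real) set" where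
  "coboundary_forms br P k = (if k = 0 then {0} else ced br ` forms P (k - 1))"

lemma subspace_cocycle_forms: "subspace (cocycle_forms br P k)"
  using subspace_forms[of P k] by (auto simp: subspace_def cocycle_forms_def ced_simps)

lemma subspace_coboundary_forms: "subspace (coboundary_forms br P k)"
  unfolding coboundary_forms_def
  using linear_subspace_image[OF linear_ced subspace_forms] by auto

lemma (in lie_bracket) coboundary_subset_cocycle:
  assumes "\<And>x y. br (P x) (P y) = P (br x y)"
  shows "coboundary_forms br P k \<subseteq> cocycle_forms br P k"
proof
  fix g assume g: "g \<in> coboundary_forms br P k"
  show "g \<in> cocycle_forms br P k"
  proof (cases k)
    case 0
    then show ?thesis using g subspace_0[OF subspace_cocycle_forms] by (simp add: coboundary_forms_def)
  next
    case (Suc m)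
    then obtain f where f: "f \<in> forms P m" "g = ced br f" using g by (auto simp: coboundary_forms_def)
    then show ?thesis
      using ced_forms[of P f m, OF assms f(1)] ced_ced[OF alt_mlin[OF formsD(1)[OF f(1)]]] Suc
      by (simp add: cocycle_forms_def)
  qed
qed

context pseudo_euclidean
begin

lemma linear_res: "linear res"
  by (rule linearI) (auto simp: res_def)

lemma linear_top_coeff: "linear top_coeff"
  by (rule linearI) (auto simp: top_coeff_def)

lemma linear_number_op: "linear number_op"
  by (rule linearI) (simp_all only: number_op_def ctr_simps wedge_simps sum.distrib scaleR_sum_right)

lemma linear_homotopy: "linear homotopy"
  by (rule linearI)
    (simp_all only: homotopy_def ctr_simps wedge_simps sum.distrib scaleR_sum_right scaleR_add_right scaleR_left_commute)

lemma linear_casimir: "linear casimir"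
  by (rule linearI)
    (simp_all add: casimir_def linear_add[OF linear_number_op] linear_scale[OF linear_number_op] algebra_simps)

lemma res_forms:
  assumes "f \<in> forms Ph k"
  shows "res f \<in> forms Pso k"
  using alt_map[OF linear_Pso formsD(1)[OF assms]] formsD(3)[OF assms]
  by (simp add: forms_def res_def[abs_def] o_def)

lemma top_coeff_forms:
  assumes "f \<in> forms Ph k" "p + q \<le> k"
  shows "top_coeff f \<in> forms Pso (k - (p + q))"
  using alt_map[OF linear_Pso alt_append[OF formsD(1)[OF assms(1)], of pds]] formsD(3)[OF assms(1)] assms(2) length_pds
  by (auto simp: forms_def top_coeff_def[abs_def] o_def simp del: upt_Suc)

lemma top_coeff_low_degree:
  assumes "f \<in> forms Ph k" "k < p + q"
  shows "top_coeff f = 0"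
  using formsD(3)[OF assms(1)] assms(2) length_pds
  by (auto simp: top_coeff_def fun_eq_iff simp del: upt_Suc)

lemma res_d: "res (d f) = ced brs (res f)"
  using ced_map[of brh Pso brs f] by (simp add: res_def[abs_def] brh_def brs_def brs_Pso fun_eq_iff)

text \<open>The translations form an ideal, so \<open>Pso\<close> is a homomorphism from
  \<open>brh\<close> to \<open>brs\<close>. The inflated forms are therefore a subcomplex on which
  \<open>res\<close> is the identity, which splits \<open>res\<close>.\<close>

lemma d_forms_Pso:
  assumes "f \<in> forms Pso k"
  shows "d f = ced brs f"
proof
  fix xs
  have "(\<lambda>zs. f (map Pso zs)) = f" using formsD(2)[OF assms] by (rule ext)
  then have "d f xs = ced brs f (map Pso xs)"
    using ced_map[of brs Pso brh f xs] by (simp add: brs_def brh_def Pso_bracket_Ph)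
  then show "d f xs = ced brs f xs" using formsD(2)[OF ced_brs_forms[OF assms]] by simp
qed

lemma res_forms_Pso: "f \<in> forms Pso k \<Longrightarrow> res f = f"
  by (simp add: res_def[abs_def] formsD(2))

lemma c_forms_Pso: "f \<in> forms Pso k \<Longrightarrow> c i f = 0"
proof -
  assume f: "f \<in> forms Pso k"
  have "c i f = ctr 0 f"
    using map_inv_ctr(2)[of Pso f "pd i", OF Pso_Pso formsD(2)[OF f]] by simp
  then show ?thesis
    using mlin_Cons0[OF alt_mlin[OF formsD(1)[OF f]]] by (simp add: ctr_def fun_eq_iff)
qed

lemma upt_I_Cons: "[1..<Suc (p + q)] = 1 # [2..<Suc (p + q)]"
proof -
  have "1 < Suc (p + q)" using pos by linarith
  from upt_conv_Cons[OF this] show ?thesis by (simp add: numeral_2_eq_2 del: upt_Suc)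
qed

lemma res_E: "res (E i f) = 0"
proof -
  have "E i f (map Pso xs) = 0" for xs
    by (induction xs arbitrary: f) simp_all
  then show ?thesis by (simp add: res_def fun_eq_iff)
qed

lemma res_number_op: "res (number_op f) = 0"
  unfolding number_op_def linear_sum[OF linear_res] res_E by simp

lemma top_coeff_number_op:
  assumes "alt f"
  shows "top_coeff (number_op f) = real (p + q) *\<^sub>R top_coeff f"
proof
  fix xs
  have 1: "filter is_pd pds = pds" using set_pds by (intro filter_True) (auto simp: is_pd_def)
  have 2: "filter is_pd (map Pso xs) = []"
  proof -
    have "\<not> is_pd (Pso x)" for x using is_pd_not_Pso[of "Pso x"] by auto
    then show ?thesis by (simp add: filter_empty_conv)
  qed
  have "number_op f (pds @ map Pso xs) = real (length (filter is_pd (pds @ map Pso xs))) * f (pds @ map Pso xs)"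
  proof (rule number_op_eval[OF assms])
    fix x assume "x \<in> set (pds @ map Pso xs)"
    then have "x \<in> pd ` I \<or> x \<in> Pso ` set xs" unfolding set_append set_pds by simp
    then show "Pso x = x \<or> is_pd x" unfolding is_pd_def by (auto simp del: atLeastAtMost_iff)
  qed
  then show "top_coeff (number_op f) xs = (real (p + q) *\<^sub>R top_coeff f) xs"
    unfolding filter_append 1 2 top_coeff_def scaleR_fun_apply append_Nil2 length_pds by simp
qed

lemma res_casimir: "res (casimir f) = 0"
  by (simp add: casimir_def linear_diff[OF linear_res] linear_scale[OF linear_res] res_number_op)

lemma top_coeff_casimir:
  assumes "f \<in> forms Ph k"
  shows "top_coeff (casimir f) = 0"
  using top_coeff_number_op[OF formsD(1)[OF assms]] top_coeff_number_op[OF formsD(1)[OF number_op_forms[OF assms]]]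
  by (simp add: casimir_def linear_diff[OF linear_top_coeff] linear_scale[OF linear_top_coeff])

lemma casimir_forms: "f \<in> forms Ph k \<Longrightarrow> casimir f \<in> forms Ph k"
  unfolding casimir_def
  by (intro subspace_diff[OF subspace_forms] subspace_scale[OF subspace_forms] number_op_forms)

lemma casimir_eq: "f \<in> forms Ph k \<Longrightarrow> casimir f = d (homotopy f) + homotopy (d f)"
  using homotopy_formula[OF formsD(1)] by (simp add: casimir_def)

lemma d_d: "f \<in> forms Ph k \<Longrightarrow> d (d f) = 0"
  by (rule brh.ced_ced[OF alt_mlin[OF formsD(1)]])

text \<open>In degree 0 the homotopy is 0, so the truncated \<open>k - 1\<close> does no
  harm.\<close>

lemma homotopy_forms': "f \<in> forms Ph k \<Longrightarrow> homotopy f \<in> forms Ph (k - 1)"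
  using homotopy_forms[of f "k - 1"] homotopy_forms_0 subspace_0[OF subspace_forms] by (cases k) auto

lemma casimir_d:
  assumes "f \<in> forms Ph k"
  shows "casimir (d f) = d (casimir f)"
  using casimir_eq[OF d_forms[OF assms]] casimir_eq[OF assms] d_d[OF assms] d_d[OF homotopy_forms'[OF assms]]
  by (simp add: ced_simps linear_0[OF linear_homotopy])

section \<open>Acyclicity of the common kernel of restriction and top coefficient\<close>

definition ker_forms :: "nat \<Rightarrow> (vf list \<Rightarrow> real) set" where
  "ker_forms k = {f \<in> forms Ph k. res f = 0 \<and> top_coeff f = 0}"

text \<open>On the closed forms of the kernel \<open>casimir\<close> is injective, hence onto by
  finite dimension, and \<open>casimir h = d (homotopy h)\<close> for closed \<open>h\<close>. Every
  value of \<open>casimir\<close> lies in the kernel. Writing \<open>f\<close> as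
  \<open>casimir (casimir h)\<close> and pulling the outer operator inside \<open>d\<close>
  therefore puts the primitive into the kernel without inspecting \<open>homotopy\<close>.\<close>

lemma ker_forms_acyclic:
  assumes "f \<in> ker_forms k" "d f = 0"
  shows "f \<in> d ` ker_forms (k - 1)"
proof -
  let ?V = "{f \<in> ker_forms k. d f = 0}"
  have "subspace ?V"
    using subspace_forms[of Ph k]
    by (auto simp: subspace_def ker_forms_def ced_simps linear_0[OF linear_res] linear_add[OF linear_res]
        linear_scale[OF linear_res] linear_0[OF linear_top_coeff] linear_add[OF linear_top_coeff] linear_scale[OF linear_top_coeff])
  moreover have "fin_dim ?V"
    by (rule fin_dim_subset[OF fin_dim_forms_Ph[of k]]) (auto simp: ker_forms_def)
  moreover have "casimir ` ?V \<subseteq> ?V"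
    using casimir_d casimir_forms res_casimir top_coeff_casimir
    by (auto simp: ker_forms_def linear_0[OF linear_casimir] casimir_d[symmetric])
  moreover have "v = 0" if "v \<in> ?V" "casimir v = 0" for v
    using that casimir_injective by (auto simp: ker_forms_def)
  ultimately have surj: "casimir ` ?V = ?V" by (rule surj_of_inj_fin_dim[OF linear_casimir])
  obtain g where g: "g \<in> ?V" "f = casimir g" using assms surj by blast
  obtain h where h: "h \<in> ?V" "g = casimir h" using g(1) surj by blast
  have hf: "h \<in> forms Ph k" "d h = 0" using h(1) by (auto simp: ker_forms_def)
  let ?u = "homotopy h"
  have u: "?u \<in> forms Ph (k - 1)" by (rule homotopy_forms'[OF hf(1)])
  have "g = d ?u" using h(2) casimir_eq[OF hf(1)] hf(2) by (simp add: linear_0[OF linear_homotopy])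
  then have "f = d (casimir ?u)" using g(2) casimir_d[OF u] by simp
  moreover have "casimir ?u \<in> ker_forms (k - 1)"
    using casimir_forms[OF u] res_casimir top_coeff_casimir[OF u] by (simp add: ker_forms_def)
  ultimately show ?thesis by blast
qed

lemma ced_brs_zero [simp]: "ced brs 0 = 0"
  by (rule linear_0[OF linear_ced])

text \<open>\<open>T\<close> is meant for the translations already contracted into \<open>f\<close>,
  \<open>zs\<close> for the arguments still to come; together with \<open>pd j\<close> they have to
  cover all translations.\<close>

lemma lieD_pd_vanish:
  assumes "alt f" "j \<in> I" "\<And>t. t \<in> T \<Longrightarrow> ctr t f = 0" "pd ` I \<subseteq> insert (pd j) (T \<union> set zs)"
  shows "lieD brh (pd j) f zs = 0"
proof -
  have "R m j (c m f) zs = 0" if m: "m \<in> I" for m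
  proof -
    consider "m = j" | "pd m \<in> T" | "pd m \<in> set zs" using assms(4) m pd_inj by blast
    then show ?thesis
    proof cases
      case 1
      have "wedge (\<lambda>_. 0) g ys = 0" for g :: "vf list \<Rightarrow> real" and ys
        by (induction ys arbitrary: g) simp_all
      moreover have "rot m j = (\<lambda>_. 0)" using 1 by (simp add: fun_eq_iff)
      ultimately show ?thesis by simp
    next
      case 2
      then show ?thesis using assms(3) by (simp add: wedge_simps)
    next
      case 3
      then obtain as bs where zs: "zs = as @ pd m # bs" by (meson split_list)
      have "c m (R m j (c m f)) = 0" by (simp add: c_R ctr_ctr_same[OF assms(1)] wedge_simps)
      then have "R m j (c m f) (pd m # as @ bs) = 0" by (metis ctr_def zero_fun_apply)
      then show ?thesis
        unfolding zs alt_move_front[OF alt_wedge[OF linear_rot alt_ctr[OF assms(1)]]] by simp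
    qed
  qed
  then show ?thesis unfolding lieD_pd[OF assms(1,2)] by (simp add: sum_fun_apply)
qed

text \<open>Brackets of a translation with a rotation only produce translations other than the given one
  (the matrix of a rotation has zero diagonal), and all of these are already arguments; hence the
  Lie derivative terms vanish by alternation.\<close>

lemma d_append_pd:
  assumes "alt f" "\<And>t. t \<in> T \<Longrightarrow> ctr t f = 0" "pd ` I \<subseteq> T \<union> set ds" "set ds \<subseteq> pd ` I"
  shows "d f (ds @ ys) = (-1) ^ length ds * d (\<lambda>zs. f (ds @ zs)) ys"
  using assms
proof (induction ds arbitrary: f T)
  case (Cons x ds)
  obtain j where j: "j \<in> I" "x = pd j" using Cons.prems(4) by auto
  have "d (ctr x f) (ds @ ys) = (-1) ^ length ds * d (\<lambda>zs. ctr x f (ds @ zs)) ys"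
  proof (rule Cons.IH[of "ctr x f" "insert x T"])
    show "alt (ctr x f)" by (rule alt_ctr[OF Cons.prems(1)])
    show "ctr t (ctr x f) = 0" if "t \<in> insert x T" for t
    proof (cases "t = x")
      case True
      then show ?thesis using ctr_ctr_same[OF Cons.prems(1)] by simp
    next
      case False
      then have "ctr t f = 0" using that Cons.prems(2)[of t] by blast
      then have "ctr x (ctr t f) = 0" using linear_0[OF linear_ctr, of x] by metis
      then show ?thesis unfolding ctr_ctr[OF Cons.prems(1), of t x] by (metis minus_zero)
    qed
  qed (use Cons.prems in auto)
  moreover have "lieD brh x f (ds @ ys) = 0"
    unfolding j(2) by (rule lieD_pd_vanish[OF Cons.prems(1) j(1) Cons.prems(2)]) (use Cons.prems(3) j in auto)
  ultimately show ?case by (simp add: ctr_def)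
qed simp

text \<open>The sign collects one factor -1 for each contraction that \<open>d\<close> is moved
  past.\<close>

lemma top_coeff_d:
  assumes "f \<in> forms Ph k"
  shows "top_coeff (d f) = (-1) ^ (p + q) *\<^sub>R ced brs (top_coeff f)"
proof
  fix xs
  have "top_coeff (d f) xs = (-1) ^ length pds * d (\<lambda>zs. f (pds @ zs)) (map Pso xs)"
    unfolding top_coeff_def
    by (rule d_append_pd[where T = "{}", OF formsD(1)[OF assms]]) (simp_all only: set_pds empty_iff Un_empty_left order_refl)
  also have "d (\<lambda>zs. f (pds @ zs)) (map Pso xs) = res (d (\<lambda>zs. f (pds @ zs))) xs" by (simp only: res_def)
  also have "\<dots> = ced brs (top_coeff f) xs"
    unfolding res_d by (simp only: res_def[abs_def] top_coeff_def[abs_def])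
  finally show "top_coeff (d f) xs = ((-1) ^ (p + q) *\<^sub>R ced brs (top_coeff f)) xs"
    unfolding length_pds by simp
qed

text \<open>The volume form times an inflated form: a right inverse of \<open>top_coeff\<close>. It
  lifts cocycles up to an element of the acyclic kernel, see
  \<open>top_coeff_Zh_res\<close>.\<close>

definition wedge_top :: "(vf list \<Rightarrow> real) \<Rightarrow> vf list \<Rightarrow> real" where
  "wedge_top f = foldr E [1..<Suc (p + q)] f"

lemma foldr_E_forms: "set is \<subseteq> I \<Longrightarrow> f \<in> forms Ph k \<Longrightarrow> foldr E is f \<in> forms Ph (k + length is)"
  by (induction "is") (auto intro: E_forms simp del: atLeastAtMost_iff)

lemma wedge_top_forms: "f \<in> forms Pso k \<Longrightarrow> wedge_top f \<in> forms Ph (k + (p + q))"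
  using foldr_E_forms[of "[1..<Suc (p + q)]" f k] forms_Pso_subset[of k]
  unfolding wedge_top_def by (simp add: atLeastLessThanSuc_atLeastAtMost subset_iff del: upt_Suc)

lemma res_wedge_top: "res (wedge_top f) = 0"
  unfolding wedge_top_def upt_I_Cons by (simp only: foldr.simps comp_apply res_E)

lemma top_coeff_wedge_top:
  assumes "f \<in> forms Pso k"
  shows "top_coeff (wedge_top f) = f"
proof -
  have z: "c i (foldr E is f) = 0" if "i \<notin> set is" for i "is"
    using that
  proof (induction "is")
    case Nil
    then show ?case using c_forms_Pso[OF assms] by simp
  next
    case (Cons j js)
    then have "c i (foldr E js f) = 0" "i \<noteq> j" by auto
    then show ?case unfolding foldr.simps comp_apply c_E by (simp add: wedge_simps)
  qed
  have "foldr E is f (map pd is @ xs) = f xs" if "distinct is" for "is" xs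
    using that
  proof (induction "is")
    case (Cons i "is")
    then show ?case using z[of i "is"] by (simp add: trl_pd wedge_simps)
  qed simp
  then have "wedge_top f (pds @ map Pso xs) = f (map Pso xs)" for xs
    unfolding wedge_top_def by (metis distinct_upt)
  then show ?thesis using formsD(2)[OF assms] by (simp add: top_coeff_def fun_eq_iff)
qed

section \<open>Images of cocycles and coboundaries, and the Betti number identity\<close>

abbreviation "Zh k \<equiv> cocycle_forms brh Ph k"
abbreviation "Bh k \<equiv> coboundary_forms brh Ph k"
abbreviation "Zs k \<equiv> cocycle_forms brs Pso k"
abbreviation "Bs k \<equiv> coboundary_forms brs Pso k"

lemma Bh_subset_Zh: "Bh k \<subseteq> Zh k"
  by (rule brh.coboundary_subset_cocycle) (simp add: brh_def brh_Ph)

lemma Bs_subset_Zs: "Bs k \<subseteq> Zs k"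
  by (rule brs.coboundary_subset_cocycle) (simp add: brs_def brs_Pso)

lemma fin_dim_Zh: "fin_dim (Zh k)"
  by (rule fin_dim_subset[OF fin_dim_forms_Ph[of k]]) (auto simp: cocycle_forms_def)

lemma fin_dim_Zs: "fin_dim (Zs k)"
  by (rule fin_dim_subset[OF fin_dim_forms_Ph[of k]]) (use forms_Pso_subset in \<open>auto simp: cocycle_forms_def\<close>)

lemma res_Zh: "res ` Zh k = Zs k"
proof
  show "res ` Zh k \<subseteq> Zs k"
    using res_forms res_d by (auto simp: cocycle_forms_def linear_0[OF linear_res] res_d[symmetric])
  show "Zs k \<subseteq> res ` Zh k"
  proof
    fix f assume "f \<in> Zs k"
    then have f: "f \<in> forms Pso k" "ced brs f = 0" by (auto simp: cocycle_forms_def)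
    then have "f \<in> Zh k" using d_forms_Pso forms_Pso_subset by (auto simp: cocycle_forms_def)
    then show "f \<in> res ` Zh k" using res_forms_Pso[OF f(1)] by (metis imageI)
  qed
qed

lemma res_Bh: "res ` Bh k = Bs k"
proof (cases k)
  case 0
  then show ?thesis by (simp add: coboundary_forms_def linear_0[OF linear_res])
next
  case (Suc m)
  have "res ` forms Ph m = forms Pso m"
  proof
    show "res ` forms Ph m \<subseteq> forms Pso m" using res_forms by blast
    show "forms Pso m \<subseteq> res ` forms Ph m"
    proof
      fix f assume "f \<in> forms Pso m"
      then show "f \<in> res ` forms Ph m" using res_forms_Pso[of f m] forms_Pso_subset by (metis imageI subsetD)
    qed
  qed
  then have "ced brs ` forms Pso m = (\<lambda>f. res (d f)) ` forms Ph m"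
    unfolding res_d by (metis image_image)
  then show ?thesis using Suc by (simp add: coboundary_forms_def image_image)
qed

abbreviation "Zh_res k \<equiv> {f \<in> Zh k. res f = 0}"
abbreviation "Bh_res k \<equiv> {f \<in> Bh k. res f = 0}"

lemma subspace_res_kernel: "subspace V \<Longrightarrow> subspace {f \<in> V. res f = 0}"
  by (auto simp: subspace_def linear_0[OF linear_res] linear_add[OF linear_res] linear_scale[OF linear_res])

lemma top_coeff_Zh_res:
  assumes "p + q \<le> k"
  shows "top_coeff ` Zh_res k = Zs (k - (p + q))"
proof
  show "top_coeff ` Zh_res k \<subseteq> Zs (k - (p + q))"
  proof
    fix g assume "g \<in> top_coeff ` Zh_res k"
    then obtain f where f: "f \<in> forms Ph k" "d f = 0" "g = top_coeff f"
      by (auto simp: cocycle_forms_def)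
    have "(-1) ^ (p + q) *\<^sub>R ced brs g = 0"
      using top_coeff_d[OF f(1)] f by (simp add: linear_0[OF linear_top_coeff])
    then have "ced brs g = 0" by (simp only: scaleR_eq_0_iff) simp
    then show "g \<in> Zs (k - (p + q))"
      using top_coeff_forms[OF f(1) assms] f(3) by (simp add: cocycle_forms_def)
  qed
  show "Zs (k - (p + q)) \<subseteq> top_coeff ` Zh_res k"
  proof
    fix g assume "g \<in> Zs (k - (p + q))"
    then have g: "g \<in> forms Pso (k - (p + q))" "ced brs g = 0" by (auto simp: cocycle_forms_def)
    let ?f = "wedge_top g"
    have f: "?f \<in> forms Ph k" using wedge_top_forms[OF g(1)] assms by simp
    \<comment> \<open>The lift is corrected rather than shown to be closed. Its differential has
      zero restriction and, as \<open>g\<close> is closed, zero top coefficient; hence it equals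
      \<open>d u\<close> with \<open>u\<close> in the kernel, and subtracting \<open>u\<close>
      leaves the top coefficient unchanged.\<close>
    have "d ?f \<in> ker_forms (Suc k)"
      using d_forms[OF f] top_coeff_d[OF f] top_coeff_wedge_top[OF g(1)] g(2)
      by (simp add: ker_forms_def res_d res_wedge_top)
    then have "d ?f \<in> d ` ker_forms k" using ker_forms_acyclic[of "d ?f" "Suc k"] d_d[OF f] by simp
    then obtain u where u: "u \<in> ker_forms k" "d ?f = d u" by blast
    then have m: "?f - u \<in> Zh_res k"
      using subspace_diff[OF subspace_forms f]
      by (simp add: ker_forms_def cocycle_forms_def ced_simps linear_diff[OF linear_res] res_wedge_top)
    have e: "top_coeff (?f - u) = g"
      using u(1) top_coeff_wedge_top[OF g(1)] by (simp add: ker_forms_def linear_diff[OF linear_top_coeff])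
    show "g \<in> top_coeff ` Zh_res k" using imageI[OF m, of top_coeff] unfolding e .
  qed
qed

lemma top_coeff_Bh_res:
  assumes "p + q \<le> k"
  shows "top_coeff ` Bh_res k = Bs (k - (p + q))"
proof -
  obtain m where m: "k = Suc m" using assms pos by (cases k) auto
  have Bh: "Bh k = d ` forms Ph m" by (simp add: coboundary_forms_def m)
  show ?thesis
  proof (cases "k = p + q")
    \<comment> \<open>Coboundaries of degree 0 are \<open>{0}\<close> by convention. This matches
      the left side, because forms of degree \<open>p + q - 1\<close> cannot take all
      \<open>p + q\<close> translations as arguments.\<close>
    case True
    have "top_coeff (d f) = 0" if "f \<in> forms Ph m" for f
      using top_coeff_d[OF that] top_coeff_low_degree[OF that] True m by simp
    moreover have "0 \<in> Bh_res k"
      using subspace_0[OF subspace_coboundary_forms] by (simp add: linear_0[OF linear_res])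
    moreover have "top_coeff 0 = 0" by (rule linear_0[OF linear_top_coeff])
    ultimately have "top_coeff ` Bh_res k \<subseteq> {0}" "0 \<in> top_coeff ` Bh_res k"
      unfolding Bh by (blast, metis (no_types, lifting) imageI)
    then have "top_coeff ` Bh_res k = {0}" by blast
    then show ?thesis using True by (simp add: coboundary_forms_def)
  next
    case False
    then have le: "p + q \<le> m" using assms m by simp
    have Bs: "Bs (k - (p + q)) = ced brs ` forms Pso (m - (p + q))"
      using m le by (simp add: coboundary_forms_def Suc_diff_le)
    show ?thesis
    proof
      show "top_coeff ` Bh_res k \<subseteq> Bs (k - (p + q))"
      proof
        fix g assume "g \<in> top_coeff ` Bh_res k"
        then obtain f where f: "f \<in> forms Ph m" "g = top_coeff (d f)" unfolding Bh by auto
        then have "g = ced brs ((-1) ^ (p + q) *\<^sub>R top_coeff f)" by (simp add: top_coeff_d ced_simps)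
        then show "g \<in> Bs (k - (p + q))" unfolding Bs
          using subspace_scale[OF subspace_forms top_coeff_forms[OF f(1) le]] by blast
      qed
      show "Bs (k - (p + q)) \<subseteq> top_coeff ` Bh_res k"
      proof
        fix g assume "g \<in> Bs (k - (p + q))"
        then obtain f where f: "f \<in> forms Pso (m - (p + q))" "g = ced brs f" unfolding Bs by blast
        \<comment> \<open>The factor compensates the sign in \<open>top_coeff_d\<close>.\<close>
        let ?f = "wedge_top ((-1) ^ (p + q) *\<^sub>R f)"
        have f': "(-1) ^ (p + q) *\<^sub>R f \<in> forms Pso (m - (p + q))"
          by (rule subspace_scale[OF subspace_forms f(1)])
        have F: "?f \<in> forms Ph m" using wedge_top_forms[OF f'] le by simp
        have e: "top_coeff (d ?f) = g"
          unfolding top_coeff_d[OF F] top_coeff_wedge_top[OF f'] ced_simps f(2)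
          by (simp flip: power_add)
        have m: "d ?f \<in> Bh_res k" unfolding Bh using F by (simp add: res_d res_wedge_top)
        show "g \<in> top_coeff ` Bh_res k" using imageI[OF m, of top_coeff] unfolding e .
      qed
    qed
  qed
qed

text \<open>The acyclicity of the kernel in the form used for counting: it makes the innermost terms
  of the two applications of rank-nullity equal.\<close>

lemma kernels_agree: "{f \<in> Zh_res k. top_coeff f = 0} = {f \<in> Bh_res k. top_coeff f = 0}"
proof
  show "{f \<in> Bh_res k. top_coeff f = 0} \<subseteq> {f \<in> Zh_res k. top_coeff f = 0}" using Bh_subset_Zh by blast
  show "{f \<in> Zh_res k. top_coeff f = 0} \<subseteq> {f \<in> Bh_res k. top_coeff f = 0}"
  proof
    fix f assume f: "f \<in> {f \<in> Zh_res k. top_coeff f = 0}"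
    then have k: "f \<in> ker_forms k" "d f = 0" by (auto simp: ker_forms_def cocycle_forms_def)
    then obtain g where g: "g \<in> ker_forms (k - 1)" "f = d g" using ker_forms_acyclic by blast
    have "f \<in> Bh k"
    proof (cases k)
      \<comment> \<open>Here \<open>k - 1\<close> is again 0, so the primitive \<open>g\<close> does
        not help: \<open>Bh 0\<close> is \<open>{0}\<close> by definition. Instead
        \<open>casimir f = 0\<close> forces \<open>f = 0\<close>.\<close>
      case 0
      then have "f \<in> forms Ph 0" using k(1) by (simp add: ker_forms_def)
      moreover have "casimir f = 0"
        using casimir_eq[OF calculation] homotopy_forms_0[OF calculation] k(2)
        by (simp add: ced_simps linear_0[OF linear_homotopy])
      ultimately have "f = 0" using casimir_injective k(1) by (simp add: ker_forms_def)
      then show ?thesis using subspace_0[OF subspace_coboundary_forms] by simp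
    next
      case (Suc m)
      then show ?thesis using g by (auto simp: coboundary_forms_def ker_forms_def)
    qed
    then show "f \<in> {f \<in> Bh_res k. top_coeff f = 0}" using f by blast
  qed
qed

text \<open>Rank-nullity is applied to \<open>res\<close> and then to \<open>top_coeff\<close> on
  the kernel of \<open>res\<close>, for cocycles and coboundaries alike; the common innermost
  dimension cancels in the difference.\<close>

theorem betti_forms:
  "dim (Zh k) - dim (Bh k) = dim (Zs k) - dim (Bs k) +
    (if p + q \<le> k then dim (Zs (k - (p + q))) - dim (Bs (k - (p + q))) else 0)"
proof -
  let ?N = "dim {f \<in> Bh_res k. top_coeff f = 0}"
  have fB: "fin_dim (Bh k)" by (rule fin_dim_subset[OF fin_dim_Zh Bh_subset_Zh])
  have fZr: "fin_dim (Zh_res k)" and fBr: "fin_dim (Bh_res k)"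
    by (rule fin_dim_subset[OF fin_dim_Zh[of k]], blast) (rule fin_dim_subset[OF fB], blast)
  note sZ = subspace_cocycle_forms[of brh Ph k] and sB = subspace_coboundary_forms[of brh Ph k]
  have Z: "dim (Zh k) = dim (Zs k) + (dim (top_coeff ` Zh_res k) + ?N)"
    using dim_rank_nullity[OF linear_res sZ fin_dim_Zh]
      dim_rank_nullity[OF linear_top_coeff subspace_res_kernel[OF sZ] fZr]
    unfolding res_Zh kernels_agree by simp
  have B: "dim (Bh k) = dim (Bs k) + (dim (top_coeff ` Bh_res k) + ?N)"
    using dim_rank_nullity[OF linear_res sB fB]
      dim_rank_nullity[OF linear_top_coeff subspace_res_kernel[OF sB] fBr]
    unfolding res_Bh by simp
  \<comment> \<open>The subtractions are truncated, so they can be combined only because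
    coboundaries never exceed cocycles in dimension.\<close>
  have le: "dim (Bs j) \<le> dim (Zs j)" for j by (rule dim_mono_fin_dim[OF fin_dim_Zs Bs_subset_Zs])
  show ?thesis
  proof (cases "p + q \<le> k")
    case True
    show ?thesis using Z B le[of k] le[of "k - (p + q)"] True
      by (simp add: top_coeff_Zh_res top_coeff_Bh_res)
  next
    case False
    have "top_coeff f = 0" if "f \<in> Zh k" for f
      using top_coeff_low_degree[of f k] that False by (simp add: cocycle_forms_def)
    then have "top_coeff ` Zh_res k \<subseteq> {0}" "top_coeff ` Bh_res k \<subseteq> {0}" using Bh_subset_Zh by blast+
    then have "dim (top_coeff ` Zh_res k) = 0" "dim (top_coeff ` Bh_res k) = 0"
      using real_vector.dim_le_card[of "top_coeff ` Zh_res k" "{}"] real_vector.dim_le_card[of "top_coeff ` Bh_res k" "{}"]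
      by simp_all
    then show ?thesis using Z B False by simp
  qed
qed

end

subsection \<open>From sequences to lists\<close>

lemma vf_add_eq: "vf_add X Y = X + Y"
  by (intro prod_eqI) (auto simp: vf_add_def fun_eq_iff)

lemma vf_scale_eq: "vf_scale c X = c *\<^sub>R X"
  by (intro prod_eqI) (auto simp: vf_scale_def fun_eq_iff)

lemma vf_zero_eq: "vf_zero = 0"
  by (intro prod_eqI) (auto simp: vf_zero_def fun_eq_iff)

definition seq_form :: "vf set \<Rightarrow> nat \<Rightarrow> (vf list \<Rightarrow> real) \<Rightarrow> (nat \<Rightarrow> vf) \<Rightarrow> real" where
  "seq_form L k f vs = (if in_dom L k vs then f (map vs [0..<k]) else 0)"

lemma linear_seq_form: "linear (seq_form L k)"
  by (rule linearI) (auto simp: seq_form_def fun_eq_iff)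

lemma map_rm:
  assumes "j \<le> k"
  shows "map (rm j vs) [0..<k] = del j (map vs [0..<Suc k])"
  using assms by (intro nth_equalityI) (auto simp: del_def rm_def nth_append min_def simp del: upt_Suc)

lemma map_upt_split:
  assumes "i < k"
  shows "map vs [0..<k] = map vs [0..<i] @ vs i # map vs [Suc i..<k]"
  using assms by (metis le0 le_add_diff_inverse less_imp_le_nat list.simps(9) map_append upt_add_eq_append upt_conv_Cons)

lemma map_upt_upd:
  assumes "i < k"
  shows "map (vs(i := u)) [0..<k] = map vs [0..<i] @ u # map vs [Suc i..<k]"
  unfolding map_upt_split[OF assms] by simp

text \<open>Both Lie algebras are ranges of linear projections. The translation between cochains on
  \<open>L\<close> and forms invariant under \<open>P\<close> is carried out here once for
  both.\<close>

locale projected_subalgebra =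
  fixes n :: nat and P :: "vf \<Rightarrow> vf" and L :: "vf set"
  assumes linear_P: "linear P"
    and P_P: "P (P x) = P x"
    and L_eq: "L = range P"
    and P_bracket: "P (vf_bracket n (P x) (P y)) = vf_bracket n (P x) (P y)"
begin

definition br :: "vf \<Rightarrow> vf \<Rightarrow> vf" where
  "br x y = vf_bracket n (P x) (P y)"

sublocale br: lie_bracket br
  unfolding br_def
  by (rule lie_bracket.lie_bracket_proj[where P = P and br = "vf_bracket n",
        OF lie_bracket_vf_bracket linear_P P_bracket])

lemma P_in_L [simp]: "P x \<in> L"
  by (simp add: L_eq)

lemma P_id: "x \<in> L \<Longrightarrow> P x = x"
  using P_P by (auto simp: L_eq)

lemma add_in_L: "x \<in> L \<Longrightarrow> y \<in> L \<Longrightarrow> x + y \<in> L"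
  using P_in_L[of "x + y"] linear_add[OF linear_P] P_id by simp

lemma scale_in_L: "x \<in> L \<Longrightarrow> a *\<^sub>R x \<in> L"
  using P_in_L[of "a *\<^sub>R x"] linear_scale[OF linear_P] P_id by simp

lemma bracket_in_L: "x \<in> L \<Longrightarrow> y \<in> L \<Longrightarrow> vf_bracket n x y \<in> L"
  using P_in_L[of "vf_bracket n (P x) (P y)"] P_bracket[of x y] P_id by metis

text \<open>The inverse of \<open>seq_form\<close>: \<open>P\<close> brings arbitrary arguments into
  \<open>L\<close>, and the padding by 0 is what \<open>in_dom\<close> demands.\<close>

definition list_form :: "nat \<Rightarrow> ((nat \<Rightarrow> vf) \<Rightarrow> real) \<Rightarrow> vf list \<Rightarrow> real" where
  "list_form k \<omega> xs = (if length xs = k then \<omega> (\<lambda>i. if i < k then P (xs ! i) else 0) else 0)"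

lemma seq_form_inject:
  assumes f: "f \<in> forms P k" and "seq_form L k f = 0"
  shows "f = 0"
proof
  fix xs
  show "f xs = 0 xs"
  proof (cases "length xs = k")
    case True
    let ?vs = "\<lambda>i. if i < k then P (xs ! i) else 0"
    have "in_dom L k ?vs" by (simp add: in_dom_def vf_zero_eq)
    moreover have "seq_form L k f ?vs = 0" unfolding assms(2) by (rule zero_fun_apply)
    ultimately have "f (map ?vs [0..<k]) = 0" unfolding seq_form_def by (simp only: if_True)
    moreover have "map ?vs [0..<k] = map P xs" using True by (intro nth_equalityI) auto
    ultimately show ?thesis using formsD(2)[OF f] by simp
  qed (simp add: formsD(3)[OF f])
qed

lemma seq_form_cochain:
  assumes f: "f \<in> forms P k"
  shows "seq_form L k f \<in> cochains L k"
proof -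
  have a: "alt f" by (rule formsD(1)[OF f])
  have dom: "in_dom L k (vs(i := u))" if "in_dom L k vs" "i < k" "u \<in> L" for vs i u
    using that by (auto simp: in_dom_def)
  have "seq_form L k f (vs(i := vf_add (vf_scale a u) w)) = a * seq_form L k f (vs(i := u)) + seq_form L k f (vs(i := w))"
    if "in_dom L k vs" "i < k" "u \<in> L" "w \<in> L" for vs i u w a
  proof -
    have "vf_add (vf_scale a u) w \<in> L" using that by (simp add: vf_add_eq vf_scale_eq add_in_L scale_in_L)
    note d = dom[OF that(1,2) this] dom[OF that(1,2,3)] dom[OF that(1,2,4)]
    note lin = mlin_arg[OF alt_mlin[OF a], of "map vs [0..<i]" "map vs [Suc i..<k]"]
    show ?thesis
      unfolding seq_form_def map_upt_upd[OF that(2)] using d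
      by (simp add: vf_add_eq vf_scale_eq linear_add[OF lin] linear_scale[OF lin])
  qed
  moreover have "seq_form L k f vs = 0" if "i < k" "j < k" "i \<noteq> j" "vs i = vs j" for vs i j
  proof -
    have "\<not> distinct (map vs [0..<k])"
      using that by (auto simp: distinct_map dest!: inj_onD[of vs "{0..<k}" i j])
    then show ?thesis using alt_repeated[OF a] by (simp add: seq_form_def)
  qed
  moreover have "seq_form L k f vs = 0" if "\<not> in_dom L k vs" for vs
    using that by (simp add: seq_form_def)
  ultimately show ?thesis unfolding cochains_def mem_Collect_eq by blast
qed

lemma list_form_forms:
  assumes w: "\<omega> \<in> cochains L k"
  shows "list_form k \<omega> \<in> forms P k"
proof -
  let ?s = "\<lambda>xs i. if i < k then P (xs ! i) else 0"
  have dom: "in_dom L k (?s xs)" for xs by (simp add: in_dom_def vf_zero_eq)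
  have lin: "\<omega> (vs(i := a *\<^sub>R u + v)) = a * \<omega> (vs(i := u)) + \<omega> (vs(i := v))"
    if "in_dom L k vs" "i < k" "u \<in> L" "v \<in> L" for vs i u v a
    using w that unfolding cochains_def vf_add_eq vf_scale_eq by blast
  have rep: "\<omega> vs = 0" if "in_dom L k vs" "i < k" "j < k" "i \<noteq> j" "vs i = vs j" for vs i j
    using w that unfolding cochains_def by blast
  have "linear (\<lambda>x. list_form k \<omega> (ys @ x # zs))" for ys zs
  proof (cases "length (ys @ 0 # zs) = k")
    case True
    let ?i = "length ys" and ?vs = "?s (ys @ 0 # zs)"
    have i: "?i < k" using True by simp
    have e: "list_form k \<omega> (ys @ x # zs) = \<omega> (?vs(?i := P x))" for x
    proof -
      have "?s (ys @ x # zs) = ?vs(?i := P x)"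
        using i by (auto simp: fun_eq_iff nth_append nth_Cons split: nat.split)
      then show ?thesis using True by (simp add: list_form_def)
    qed
    have l: "\<omega> (?vs(?i := a *\<^sub>R P x + P y)) = a * \<omega> (?vs(?i := P x)) + \<omega> (?vs(?i := P y))" for a x y
      by (rule lin[OF dom i]) simp_all
    have z: "\<omega> (?vs(?i := 0)) = 0" using l[of 1 0 0] linear_0[OF linear_P] by simp
    show ?thesis unfolding e
    proof (rule linearI)
      show "\<omega> (?vs(?i := P (x + y))) = \<omega> (?vs(?i := P x)) + \<omega> (?vs(?i := P y))" for x y
        using l[of 1 x y] by (simp add: linear_add[OF linear_P])
      show "\<omega> (?vs(?i := P (a *\<^sub>R x))) = a *\<^sub>R \<omega> (?vs(?i := P x))" for a x
        using l[of a x 0] z by (simp add: linear_scale[OF linear_P] linear_0[OF linear_P])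
    qed
  next
    case False
    then show ?thesis by (simp add: list_form_def linear_iff)
  qed
  moreover have "list_form k \<omega> (ys @ x # x # zs) = 0" for ys x zs
  proof (cases "length (ys @ x # x # zs) = k")
    case True
    have "\<omega> (?s (ys @ x # x # zs)) = 0"
      by (rule rep[OF dom, of "length ys" "Suc (length ys)"]) (use True in \<open>auto simp: nth_append\<close>)
    then show ?thesis by (simp add: list_form_def)
  qed (simp add: list_form_def)
  moreover have "list_form k \<omega> (map P xs) = list_form k \<omega> xs" for xs
  proof (cases "length xs = k")
    case True
    then have "?s (map P xs) = ?s xs" by (auto simp: fun_eq_iff P_P)
    then show ?thesis by (simp add: list_form_def)
  qed (simp add: list_form_def)
  ultimately show ?thesis by (simp add: forms_def alt_def mlin_def list_form_def)
qed

lemma seq_form_list_form: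
  assumes w: "\<omega> \<in> cochains L k"
  shows "seq_form L k (list_form k \<omega>) = \<omega>"
proof
  fix vs
  show "seq_form L k (list_form k \<omega>) vs = \<omega> vs"
  proof (cases "in_dom L k vs")
    case True
    then have "(\<lambda>i. if i < k then P (map vs [0..<k] ! i) else 0) = vs"
      by (auto simp: fun_eq_iff in_dom_def P_id vf_zero_eq)
    then show ?thesis using True by (simp add: seq_form_def list_form_def)
  next
    case False
    then show ?thesis using w by (simp add: seq_form_def cochains_def)
  qed
qed

lemma cochains_eq: "cochains L k = seq_form L k ` forms P k"
  using seq_form_cochain list_form_forms seq_form_list_form by (metis (no_types, lifting) image_eqI image_subsetI subsetI subset_antisym)

lemma ce_d_seq_form:
  assumes f: "f \<in> forms P k"
  shows "ce_d (vf_bracket n) L k (seq_form L k f) = seq_form L (Suc k) (ced br f)"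
proof
  fix vs
  show "ce_d (vf_bracket n) L k (seq_form L k f) vs = seq_form L (Suc k) (ced br f) vs"
  proof (cases "in_dom L (Suc k) vs")
    case True
    let ?xs = "map vs [0..<Suc k]"
    let ?ws = "\<lambda>i j m. if m = 0 then vf_bracket n (vs i) (vs j) else rm i (rm j vs) (m - 1)"
    have L: "vs i \<in> L" if "i \<le> k" for i using True that by (simp add: in_dom_def)
    have summand: "seq_form L k f (?ws i j) = f (br (?xs ! i) (?xs ! j) # del i (del j ?xs))" if ij: "i < j" "j \<le> k" for i j
    proof -
      \<comment> \<open>Two of the \<open>Suc k\<close> arguments are removed and a bracket is put
        in front, so \<open>m = k - 1\<close> old arguments remain behind it; \<open>i < j\<close>
        excludes \<open>k = 0\<close>.\<close>
      obtain m where m: "k = Suc m" using ij by (cases k) auto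
      have "?ws i j l \<in> L" if "l < k" for l
        using that ij L bracket_in_L by (auto simp: rm_def)
      moreover have "?ws i j l = vf_zero" if "l \<ge> k" for l
        using that ij True m by (auto simp: rm_def in_dom_def)
      ultimately have dom: "in_dom L k (?ws i j)" unfolding in_dom_def by blast
      have 1: "map (?ws i j) [0..<k] = vf_bracket n (vs i) (vs j) # map (rm i (rm j vs)) [0..<m]"
        unfolding m by (simp only: upt_conv_Cons zero_less_Suc list.simps map_Suc_upt[symmetric] map_map) (simp add: o_def)
      have 2: "map (rm i (rm j vs)) [0..<m] = del i (del j ?xs)"
        using map_rm[of i m "rm j vs"] map_rm[of j k vs] ij m by (simp del: upt_Suc)
      have 3: "vf_bracket n (vs i) (vs j) = br (?xs ! i) (?xs ! j)"
        using ij L by (simp add: br_def P_id del: upt_Suc)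
      show ?thesis using dom unfolding seq_form_def 1 2 unfolding 3 by (simp only: if_True)
    qed
    have "ce_d (vf_bracket n) L k (seq_form L k f) vs =
      (\<Sum>j\<in>{..k}. \<Sum>i\<in>{..<j}. (-1) ^ (i + j) * seq_form L k f (?ws i j))"
      using True by (simp only: ce_d_def if_True)
    also have "\<dots> = (\<Sum>j\<in>{..k}. \<Sum>i\<in>{..<j}. (-1) ^ (i + j) * f (br (?xs ! i) (?xs ! j) # del i (del j ?xs)))"
      by (intro sum.cong refl) (simp add: summand del: upt_Suc)
    also have "\<dots> = ced br f ?xs"
      unfolding ced_eq_sum[OF formsD(1)[OF f]] by (simp add: lessThan_Suc_atMost del: upt_Suc)
    finally show ?thesis using True by (simp add: seq_form_def del: upt_Suc)
  qed (simp add: ce_d_def seq_form_def)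
qed

lemma br_P: "br (P x) (P y) = P (br x y)"
  by (simp add: br_def P_P P_bracket)

lemma cocycles_eq: "cocycles (vf_bracket n) L k = seq_form L k ` cocycle_forms br P k"
proof -
  have "ce_d (vf_bracket n) L k (seq_form L k f) = 0 \<longleftrightarrow> ced br f = 0" if f: "f \<in> forms P k" for f
    unfolding ce_d_seq_form[OF f]
    using seq_form_inject[OF br.ced_forms[OF br_P f]] linear_0[OF linear_seq_form] by metis
  then show ?thesis unfolding cocycles_def cochains_eq cocycle_forms_def by blast
qed

lemma coboundaries_eq: "coboundaries (vf_bracket n) L k = seq_form L k ` coboundary_forms br P k"
proof (cases k)
  case 0
  then show ?thesis
    by (simp add: coboundaries_def coboundary_forms_def linear_0[OF linear_seq_form])
next
  case (Suc m)
  have "ce_d (vf_bracket n) L m ` cochains L m = seq_form L (Suc m) ` ced br ` forms P m"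
    unfolding cochains_eq image_image by (rule image_cong[OF refl ce_d_seq_form])
  then show ?thesis using Suc by (simp add: coboundaries_def coboundary_forms_def)
qed

lemma lie_betti_eq:
  "lie_betti (vf_bracket n) L k = dim (cocycle_forms br P k) - dim (coboundary_forms br P k)"
proof -
  have "dim (seq_form L k ` V) = dim V" if "subspace V" "V \<subseteq> forms P k" for V
    using that by (intro dim_image_inj[OF linear_seq_form]) (auto intro: seq_form_inject)
  moreover have "cocycle_forms br P k \<subseteq> forms P k" by (auto simp: cocycle_forms_def)
  moreover have "coboundary_forms br P k \<subseteq> forms P k"
    using br.coboundary_subset_cocycle[of P k, OF br_P] calculation(2) by blast
  ultimately show ?thesis
    unfolding lie_betti_def fdim_eq_dim cocycles_eq coboundaries_eq
    using subspace_cocycle_forms subspace_coboundary_forms by metis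
qed

end

text \<open>Finiteness matters: over an infinite \<open>G\<close> the sums in \<open>vf_span\<close>
  would be 0 by default.\<close>

lemma vf_span_eq_span:
  assumes "finite G"
  shows "vf_span G = span G"
proof -
  have "(fst X = (\<lambda>i j. \<Sum>g\<in>G. c g * fst g i j) \<and> snd X = (\<lambda>i. \<Sum>g\<in>G. c g * snd g i)) \<longleftrightarrow>
    X = (\<Sum>g\<in>G. c g *\<^sub>R g)" for X and c :: "vf \<Rightarrow> real"
    by (auto simp: prod_eq_iff fst_sum snd_sum fun_eq_iff sum_fun_apply)
  then show ?thesis unfolding vf_span_def span_finite[OF assms] by auto
qed

section \<open>Identification of the algebras spanned by the given generators\<close>

context pseudo_euclidean
begin

lemma fst_alpha: "fst (alpha i j) a b = (if a = j \<and> b = i then 1 else 0) - (if a = i \<and> b = j then 1 else 0)"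
  by (simp add: alpha_def vf_add_eq vf_scale_eq xd_def)

lemma fst_beta: "fst (beta i j) a b = (if a = j \<and> b = i then 1 else 0) + (if a = i \<and> b = j then 1 else 0)"
  by (simp add: beta_def vf_add_eq xd_def)

lemma snd_alpha: "snd (alpha i j) = 0"
  by (simp add: alpha_def vf_add_eq vf_scale_eq xd_def fun_eq_iff)

lemma snd_beta: "snd (beta i j) = 0"
  by (simp add: beta_def vf_add_eq xd_def fun_eq_iff)

lemma alpha_eq:
  assumes "sg i = sg j"
  shows "alpha i j = - sg i *\<^sub>R so_basis i j"
proof (rule prod_eqI)
  have "sg i * sg j = 1" using sg_sq[of j] assms by simp
  then have "fst (alpha i j) a b = - sg i * fst (so_basis i j) a b" for a b
    unfolding fst_alpha fst_so_basis
    by (cases "a = i"; cases "b = j"; cases "a = j"; cases "b = i") simp_all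
  then show "fst (alpha i j) = fst (- sg i *\<^sub>R so_basis i j)"
    by (intro ext) simp
qed (simp add: snd_alpha)

lemma beta_eq:
  assumes "i \<le> p" "p < j"
  shows "beta i j = - so_basis i j"
proof (rule prod_eqI)
  have "sg i = 1" "sg j = - 1" "i \<noteq> j" using assms by (simp_all add: sg_def)
  then have "fst (beta i j) a b = - fst (so_basis i j) a b" for a b
    unfolding fst_beta fst_so_basis
    by (cases "a = i"; cases "b = j"; cases "a = j"; cases "b = i") simp_all
  then show "fst (beta i j) = fst (- so_basis i j)" by (intro ext) simp
qed (simp add: snd_beta)

lemma so_basis_skew: "so_basis i j = - so_basis j i"
proof (rule prod_eqI)
  have "fst (so_basis i j) a b = - fst (so_basis j i) a b" for a b
    unfolding fst_so_basis by (simp only: minus_diff_eq)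
  then show "fst (so_basis i j) = fst (- so_basis j i)" by (intro ext) simp
qed simp

lemma so_basis_diag: "so_basis i i = 0"
  by (rule prod_eqI) (simp_all add: so_basis_def fun_eq_iff)

lemma so_gens_subset: "so_gens p q \<subseteq> range Pso"
proof
  fix x assume "x \<in> so_gens p q"
  then consider (a) i j where "x = alpha i j" "sg i = sg j" "i \<in> I" "j \<in> I"
    | (b) i j where "x = beta i j" "i \<le> p" "p < j" "i \<in> I" "j \<in> I"
    unfolding so_gens_def by (auto simp: sg_def)
  then have "Pso x = x"
  proof cases
    case a
    then show ?thesis by (simp only: alpha_eq linear_scale[OF linear_Pso] Pso_so_basis)
  next
    case b
    then show ?thesis by (simp only: beta_eq linear_neg[OF linear_Pso] Pso_so_basis)
  qed
  then show "x \<in> range Pso" by (metis rangeI)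
qed

lemma so_basis_in_span:
  assumes "i \<in> I" "j \<in> I"
  shows "so_basis i j \<in> span (so_gens p q)"
proof -
  \<comment> \<open>For \<open>i < j\<close> the pair lies across the blocks, giving a
    \<open>beta\<close>, or inside one block, giving an \<open>alpha\<close>; the remaining pairs
    follow by antisymmetry.\<close>
  have less: "so_basis i j \<in> span (so_gens p q)" if "i \<in> I" "j \<in> I" "i < j" for i j
  proof (cases "i \<le> p \<and> p < j")
    case True
    then have "beta i j \<in> so_gens p q" using that unfolding so_gens_def by auto
    then have "- beta i j \<in> span (so_gens p q)" by (intro span_neg span_base)
    then show ?thesis using True by (simp add: beta_eq)
  next
    case False
    then have "(1 \<le> i \<and> i < j \<and> j \<le> p) \<or> (p + 1 \<le> i \<and> i < j \<and> j \<le> p + q)" using that by auto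
    then have "alpha i j \<in> so_gens p q" unfolding so_gens_def by blast
    then have "- sg i *\<^sub>R alpha i j \<in> span (so_gens p q)" by (intro span_scale span_base)
    moreover have "sg i = sg j" using False that by (auto simp: sg_def)
    ultimately show ?thesis by (simp add: alpha_eq)
  qed
  consider "i < j" | "j < i" | "i = j" by linarith
  then show ?thesis
  proof cases
    case 1
    then show ?thesis using less assms by blast
  next
    case 2
    then have "- so_basis j i \<in> span (so_gens p q)" using less assms by (intro span_neg) blast
    then show ?thesis using so_basis_skew by metis
  next
    case 3
    then show ?thesis using so_basis_diag span_zero by metis
  qed
qed

lemma span_so_gens: "span (so_gens p q) = range Pso"
proof
  show "span (so_gens p q) \<subseteq> range Pso"
    using so_gens_subset linear_subspace_image[OF linear_Pso subspace_UNIV] by (rule span_minimal)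
  show "range Pso \<subseteq> span (so_gens p q)"
    unfolding Pso_decomp[abs_def]
    by (auto intro!: span_sum span_scale so_basis_in_span simp del: atLeastAtMost_iff)
qed

lemma transl_gens_eq: "transl_gens (p + q) = pd ` I"
  by (auto simp: transl_gens_def)

lemma Ph_pd: "i \<in> I \<Longrightarrow> Ph (pd i) = pd i"
proof -
  assume i: "i \<in> I"
  have "fst (pd i) = 0" by (simp add: pd_def fun_eq_iff)
  moreover have "snd (pd i) j = 0" if "j \<notin> I" for j
  proof -
    have "j \<noteq> i" using i that by blast
    then show ?thesis by (simp add: pd_def)
  qed
  ultimately show ?thesis unfolding Ph_fix_iff Pso_pd by (simp only: fst_zero simp_thms) blast
qed

lemma span_h_gens: "span (so_gens p q \<union> transl_gens (p + q)) = range Ph"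
proof
  have "so_gens p q \<union> transl_gens (p + q) \<subseteq> range Ph"
  proof (rule Un_least)
    show "so_gens p q \<subseteq> range Ph" using so_gens_subset Ph_Pso by (metis image_subset_iff rangeI subset_trans)
    show "transl_gens (p + q) \<subseteq> range Ph" unfolding transl_gens_eq
    proof (rule image_subsetI)
      show "pd i \<in> range Ph" if "i \<in> I" for i using Ph_pd[OF that] by (metis rangeI)
    qed
  qed
  then show "span (so_gens p q \<union> transl_gens (p + q)) \<subseteq> range Ph"
    using linear_subspace_image[OF linear_Ph subspace_UNIV] by (rule span_minimal)
  have "Pso v \<in> span (so_gens p q \<union> pd ` I)" for v
    using span_so_gens span_mono[of "so_gens p q" "so_gens p q \<union> pd ` I"] by blast
  moreover have "pd i \<in> span (so_gens p q \<union> pd ` I)" if "i \<in> I" for i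
    using that by (intro span_base) blast
  ultimately have "Ph v \<in> span (so_gens p q \<union> pd ` I)" for v
    unfolding Ph_eq by (intro span_add span_sum span_scale)
  then show "range Ph \<subseteq> span (so_gens p q \<union> transl_gens (p + q))"
    unfolding transl_gens_eq by (rule image_subsetI)
qed

lemma finite_so_gens: "finite (so_gens p q)"
proof -
  let ?J = "{..p + q} \<times> {..p + q}"
  have "x \<in> (\<lambda>(i, j). alpha i j) ` ?J \<union> (\<lambda>(i, j). beta i j) ` ?J" if x: "x \<in> so_gens p q" for x
  proof -
    from x obtain i j where ij: "(i < j \<and> j \<le> p) \<or> (i < j \<and> j \<le> p + q) \<or> (i \<le> p \<and> j \<le> p + q)"
      "x = alpha i j \<or> x = beta i j"
      unfolding so_gens_def by blast
    have "i \<le> p + q" "j \<le> p + q" using ij(1) by linarith+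
    then have "(i, j) \<in> ?J" by simp
    then show ?thesis using ij(2) by (metis (no_types, lifting) UnI1 UnI2 case_prod_conv image_eqI)
  qed
  then have "so_gens p q \<subseteq> (\<lambda>(i, j). alpha i j) ` ?J \<union> (\<lambda>(i, j). beta i j) ` ?J" by (rule subsetI)
  then show ?thesis by (rule finite_subset) simp
qed

lemma so_alg_eq: "so_alg p q = range Pso"
  unfolding so_alg_def vf_span_eq_span[OF finite_so_gens] by (rule span_so_gens)

lemma h_alg_eq: "h_alg p q = range Ph"
proof -
  have "finite (so_gens p q \<union> transl_gens (p + q))" by (simp add: finite_so_gens transl_gens_eq)
  then show ?thesis unfolding h_alg_def by (simp only: vf_span_eq_span span_h_gens)
qed

sublocale so: projected_subalgebra "p + q" Pso "so_alg p q"
  by (rule projected_subalgebra.intro) (simp_all add: linear_Pso so_alg_eq brs_Pso)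

sublocale h: projected_subalgebra "p + q" Ph "h_alg p q"
  by (rule projected_subalgebra.intro) (simp_all add: linear_Ph h_alg_eq brh_Ph)

lemma so_br: "so.br = brs" and h_br: "h.br = brh"
  by (simp_all add: fun_eq_iff so.br_def brs_def h.br_def brh_def)

lemma lie_betti_h_alg:
  "lie_betti (vf_bracket (p + q)) (h_alg p q) k = lie_betti (vf_bracket (p + q)) (so_alg p q) k +
    (if p + q \<le> k then lie_betti (vf_bracket (p + q)) (so_alg p q) (k - (p + q)) else 0)"
  unfolding h.lie_betti_eq so.lie_betti_eq so_br h_br by (rule betti_forms)

end

theorem theorem6p2:
  fixes p q :: nat
  assumes "p + q \<ge> 4"
  shows "\<forall>k. lie_betti (vf_bracket (p + q)) (h_alg p q) k
           = lie_betti (vf_bracket (p + q)) (so_alg p q) k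
             + (if p + q \<le> k then lie_betti (vf_bracket (p + q)) (so_alg p q) (k - (p + q)) else 0)"
proof -
  interpret pseudo_euclidean p q by unfold_locales (use assms in simp)
  show ?thesis using lie_betti_h_alg by blast
qed

end
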